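(* Let $a>0$, let $\Lambda=\{(2\pi\tilde k a,\,2\pi\tilde l a): \tilde k,\tilde l\in\mathbb{Z}\}\subset\mathbb{R}^2$, and let $T^2=\mathbb{R}^2/\Lambda$ be the square torus with the flat metric induced from $\mathbb{R}^2$. Then: (a) $T^2$ admits a (full, isometric) proper-biharmonic immersion into the unit sphere $\mathbb{S}^n$, with $n\equiv 3\pmod 4$, with constant mean curvature $h\in(0,1)$ if and only if $$4a^2=p_1^2+q_1^2+p_2^2+q_2^2,\qquad h=\frac{p_2^2+q_2^2-p_1^2-q_1^2}{p_1^2+q_1^2+p_2^2+q_2^2},$$ and $$7\le n\le r_2(p_1^2+q_1^2)+r_2(p_2^2+q_2^2)-1,$$ for some $p_1,q_1,p_2,q_2\in\mathbb{N}$ with $0<p_1^2+q_1^2<p_2^2+q_2^2$. (b) If $4a^2=p^2+q^2$ with $p,q\in\mathbb{N}$, $0<p<q$, then $T^2$ admits a (full, isometric) CMC proper-biharmonic immersion into $\mathbb{S}^n$ with mean curvature $h=(q^2-p^2)/(p^2+q^2)$ for every odd $n$ with $5\le n\le r_2(p^2)+r_2(q^2)-1$.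
   Context: For $p\in\mathbb{N}$, $r_2(p)$ denotes the number of representations of $p$ as a sum of two squares of integers, i.e. the number of pairs $(x,y)\in\mathbb{Z}^2$ with $x^2+y^2=p$. A map $\phi:(M,g)\to(N,\tilde g)$ between Riemannian manifolds is biharmonic if it is a critical point of the bienergy $E_2(\phi)=\frac12\int_M|\tau(\phi)|^2v_g$, equivalently if $\tau_2(\phi)=-\Delta\tau(\phi)-\operatorname{trace}R^N(d\phi,\tau(\phi))d\phi=0$, where $\tau(\phi)$ is the tension field; it is proper-biharmonic if biharmonic but not harmonic. For an isometric immersion of a surface the mean curvature is $h=|H|$; CMC means $h$ is constant. Immersions are isometric and full, i.e. their image does not lie in any totally geodesic sphere $\mathbb{S}^{n'}\subset\mathbb{S}^n$ with $n'<n$. $\mathbb{N}$ includes $0$. *)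

theory Defs
  imports "HOL-Analysis.Analysis"
begin

definition r2 :: "nat \<Rightarrow> nat" where
  "r2 p = card {xy :: int \<times> int. (fst xy)^2 + (snd xy)^2 = int p}"

text \<open>Maps R^2 -> R^(n+1) are represented componentwise: phi i is the i-th
  component (only i \<le> n matters). Coordinates (x,y) of R^2 are flat Euclidean.\<close>
type_synonym vmap = "nat \<Rightarrow> real \<times> real \<Rightarrow> real"

definition pdx :: "(real \<times> real \<Rightarrow> real) \<Rightarrow> real \<times> real \<Rightarrow> real" where
  "pdx f = (\<lambda>(x, y). deriv (\<lambda>t. f (t, y)) x)"

definition pdy :: "(real \<times> real \<Rightarrow> real) \<Rightarrow> real \<times> real \<Rightarrow> real" where
  "pdy f = (\<lambda>(x, y). deriv (\<lambda>t. f (x, t)) y)"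

definition smooth2 :: "(real \<times> real \<Rightarrow> real) \<Rightarrow> bool" where
  "smooth2 f \<longleftrightarrow> (\<exists>D :: nat \<Rightarrow> nat \<Rightarrow> real \<times> real \<Rightarrow> real. D 0 0 = f \<and>
     (\<forall>i j p. (D i j has_derivative
        (\<lambda>h. D (Suc i) j p * fst h + D i (Suc j) p * snd h)) (at p)))"

definition dx :: "vmap \<Rightarrow> vmap" where "dx V = (\<lambda>i. pdx (V i))"
definition dy :: "vmap \<Rightarrow> vmap" where "dy V = (\<lambda>i. pdy (V i))"

definition ip :: "nat \<Rightarrow> (nat \<Rightarrow> real) \<Rightarrow> (nat \<Rightarrow> real) \<Rightarrow> real" where
  "ip n u v = (\<Sum>i\<le>n. u i * v i)"

definition at_pt :: "vmap \<Rightarrow> real \<times> real \<Rightarrow> nat \<Rightarrow> real" where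
  "at_pt V p = (\<lambda>i. V i p)"

definition proj :: "nat \<Rightarrow> vmap \<Rightarrow> real \<times> real \<Rightarrow> (nat \<Rightarrow> real) \<Rightarrow> nat \<Rightarrow> real" where
  "proj n phi p v = (\<lambda>i. v i - ip n v (at_pt phi p) * phi i p)"

text \<open>Tension field tau(phi) = trace nabla d phi (flat domain, sphere target).\<close>
definition tension :: "nat \<Rightarrow> vmap \<Rightarrow> vmap" where
  "tension n phi = (\<lambda>i p. proj n phi p (at_pt (dx (dx phi)) p) i
                        + proj n phi p (at_pt (dy (dy phi)) p) i)"

text \<open>Mean curvature vector H = (1/2) trace B = tau/2 and h = |H|.\<close>
definition mean_curv :: "nat \<Rightarrow> vmap \<Rightarrow> real \<times> real \<Rightarrow> real" where
  "mean_curv n phi p = sqrt (ip n (at_pt (\<lambda>i q. tension n phi i q / 2) p)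
                                  (at_pt (\<lambda>i q. tension n phi i q / 2) p))"

text \<open>nabla^phi_{e_k} nabla^phi_{e_k} V for a section V of phi^{-1} T S^n, D = d/dx or d/dy.\<close>
definition rough_term :: "nat \<Rightarrow> vmap \<Rightarrow> vmap \<Rightarrow> (vmap \<Rightarrow> vmap) \<Rightarrow> vmap" where
  "rough_term n phi V D = (\<lambda>i p. proj n phi p (at_pt (D (D V)) p) i
       - ip n (at_pt (D V) p) (at_pt phi p) * D phi i p)"

text \<open>R^{S^n}(d phi e_k, V) d phi e_k with R(X,Y)Z = <Y,Z>X - <X,Z>Y.\<close>
definition curv_term :: "nat \<Rightarrow> vmap \<Rightarrow> vmap \<Rightarrow> (vmap \<Rightarrow> vmap) \<Rightarrow> vmap" where
  "curv_term n phi V D = (\<lambda>i p. ip n (at_pt V p) (at_pt (D phi) p) * D phi i p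
       - ip n (at_pt (D phi) p) (at_pt (D phi) p) * V i p)"

text \<open>Bitension field tau_2 = -Delta tau - trace R(d phi, tau) d phi
  = trace nabla nabla tau - trace R(d phi, tau) d phi.\<close>
definition bitension :: "nat \<Rightarrow> vmap \<Rightarrow> vmap" where
  "bitension n phi = (let V = tension n phi in
     (\<lambda>i p. rough_term n phi V dx i p + rough_term n phi V dy i p
           - curv_term n phi V dx i p - curv_term n phi V dy i p))"

text \<open>A full isometric immersion of the square torus R^2 / (2 pi a Z)^2 into S^n,
  given as a Lambda-periodic smooth map R^2 -> S^n in R^(n+1).\<close>
definition torus_full_isometric_immersion :: "real \<Rightarrow> nat \<Rightarrow> vmap \<Rightarrow> bool" where
  "torus_full_isometric_immersion a n phi \<longleftrightarrow>
     (\<forall>i\<le>n. smooth2 (phi i)) \<and>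
     (\<forall>p. ip n (at_pt phi p) (at_pt phi p) = 1) \<and>
     (\<forall>i\<le>n. \<forall>x y. phi i (x + 2*pi*a, y) = phi i (x, y) \<and> phi i (x, y + 2*pi*a) = phi i (x, y)) \<and>
     (\<forall>p. ip n (at_pt (dx phi) p) (at_pt (dx phi) p) = 1 \<and>
          ip n (at_pt (dy phi) p) (at_pt (dy phi) p) = 1 \<and>
          ip n (at_pt (dx phi) p) (at_pt (dy phi) p) = 0) \<and>
     (\<forall>c. (\<forall>p. ip n c (at_pt phi p) = 0) \<longrightarrow> (\<forall>i\<le>n. c i = 0))"

definition biharmonic :: "nat \<Rightarrow> vmap \<Rightarrow> bool" where
  "biharmonic n phi \<longleftrightarrow> (\<forall>i\<le>n. \<forall>p. bitension n phi i p = 0)"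

definition harmonic :: "nat \<Rightarrow> vmap \<Rightarrow> bool" where
  "harmonic n phi \<longleftrightarrow> (\<forall>i\<le>n. \<forall>p. tension n phi i p = 0)"

definition proper_biharmonic :: "nat \<Rightarrow> vmap \<Rightarrow> bool" where
  "proper_biharmonic n phi \<longleftrightarrow> biharmonic n phi \<and> \<not> harmonic n phi"

definition CMC_torus_biharmonic :: "real \<Rightarrow> nat \<Rightarrow> real \<Rightarrow> bool" where
  "CMC_torus_biharmonic a n h \<longleftrightarrow> (\<exists>phi. torus_full_isometric_immersion a n phi \<and>
      proper_biharmonic n phi \<and> (\<forall>p. mean_curv n phi p = h))"

end

theory Submission
  imports Defs
begin

text \<open>
  Write L for the flat Laplacian and \<tau> for the tension field of an isometric immersion \<phi>. Then
  L \<phi> = \<tau> - 2 \<phi>, and biharmonicity with constant mean curvature h reads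
  L \<tau> = - 2 \<tau> + 4 h^2 \<phi>. Hence \<phi>/2 + s \<tau>/(4 h) is, for s = 1 and s = -1, an
  eigenfunction of L with eigenvalue - (2 - 2 s h), so its Fourier coefficients live on the frequencies
  v in Z^2 with |v|^2 = (2 - 2 s h) a^2. This yields the arithmetic conditions, and fullness bounds n + 1
  by the number of these frequencies. In codimension one the Gauss equation and |B|^2 = 2 force h = 0,
  which excludes n = 3.

  Conversely, \<phi> is built from the real characters cas(v . p / a) with cas = cos + sin, which are
  indexed by all of Z^2, so that a symmetric set of n + 1 frequencies gives exactly n + 1 coordinates.
  With positive weights, the condition that \<phi> is isometric is linear in the weights. Orbits of the
  rotation by a right angle, equally weighted, contribute a multiple of the identity to the metric,
  which settles n = 3 modulo 4; for n = 1 modulo 4 one adds the frequencies (p,0), (q,0), (0,q) and their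
  negatives, with weights that restore isotropy.
\<close>

section \<open>Smooth functions and linear algebra\<close>

text \<open>The Laplacian acts on the span of \<open>phi\<close> and the tension field with diagonal
  entries -2 and off-diagonal entries 1 and 4 h^2, whence the eigenvalues -2 + 2 h and -2 - 2 h; the
  squared radii m1 < m2 of the two frequency circles therefore add up to 4 a^2. The tension field is
  orthogonal to \<open>phi\<close> and has length 2 h, so both spectral components have squared
  length 1/2: this is the mass prescribed on each circle in the converse. Masses 1/2 on both circles
  give a second moment matrix of trace (m1 + m2) / 2 = 2 a^2 automatically, so being isometric only
  asks that this matrix be scalar. Orbits of the right-angle rotation have four points, so whole
  orbits reach only the n with 4 dividing n + 1; this is the origin of the residue class. For the
  other odd n, half an orbit is omitted on the smaller circle, and unequal weights on the axis
  points of the larger one cancel the resulting anisotropy.\<close>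

lemma smooth2_partials:
  assumes "smooth2 f"
  obtains D where "D 0 0 = f" and "\<And>i j. smooth2 (D i j)"
    and "\<And>i j x y. ((\<lambda>t. D i j (t, y)) has_real_derivative D (Suc i) j (x, y)) (at x)"
    and "\<And>i j x y. ((\<lambda>t. D i j (x, t)) has_real_derivative D i (Suc j) (x, y)) (at y)"
    and "\<And>i j. continuous_on UNIV (D i j)"
proof -
  from assms obtain D where D0: "D 0 0 = f" and D: "\<And>i j p. (D i j has_derivative
        (\<lambda>h. D (Suc i) j p * fst h + D i (Suc j) p * snd h)) (at p)"
    unfolding smooth2_def by blast
  show thesis
  proof (rule that[of D])
    show "D 0 0 = f" by (fact D0)
    show "smooth2 (D i j)" for i j
      unfolding smooth2_def
      by (rule exI[of _ "\<lambda>i' j'. D (i + i') (j + j')"]) (auto intro: D)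
    show "((\<lambda>t. D i j (t, y)) has_real_derivative D (Suc i) j (x, y)) (at x)" for i j x y
    proof -
      have "((\<lambda>t. (t, y)) has_derivative (\<lambda>h. (h, 0))) (at x)"
        by (auto intro!: derivative_eq_intros)
      from has_derivative_compose[OF this D[of i j "(x, y)"]]
      show ?thesis by (simp add: has_field_derivative_def)
    qed
    show "((\<lambda>t. D i j (x, t)) has_real_derivative D i (Suc j) (x, y)) (at y)" for i j x y
    proof -
      have "((\<lambda>t. (x, t)) has_derivative (\<lambda>h. (0, h))) (at y)"
        by (auto intro!: derivative_eq_intros)
      from has_derivative_compose[OF this D[of i j "(x, y)"]]
      show ?thesis by (simp add: has_field_derivative_def)
    qed
    show "continuous_on UNIV (D i j)" for i j
      by (intro continuous_at_imp_continuous_on ballI has_derivative_continuous[OF D])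
  qed
qed

lemma pdx_eqI:
  assumes "\<And>x y. ((\<lambda>t. f (t, y)) has_real_derivative g (x, y)) (at x)"
  shows "pdx f = g"
  unfolding pdx_def using assms by (auto intro!: DERIV_imp_deriv)

lemma pdy_eqI:
  assumes "\<And>x y. ((\<lambda>t. f (x, t)) has_real_derivative g (x, y)) (at y)"
  shows "pdy f = g"
  unfolding pdy_def using assms by (auto intro!: DERIV_imp_deriv)

text \<open>Mixed partials commute because the family \<open>D\<close> behind \<open>smooth2\<close>
  already encodes it: \<open>D 1 1\<close> is a derivative of both \<open>D 1 0\<close> and
  \<open>D 0 1\<close>.\<close>

lemma smooth2_pdx [simp]: "smooth2 (pdx f)"
  and smooth2_pdy [simp]: "smooth2 (pdy f)"
  and pdx_pdy_commute: "pdx (pdy f) = pdy (pdx f)"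
  and smooth2_continuous: "continuous_on UNIV f"
  and smooth2_has_pdx:
    "((\<lambda>t. f (t, y)) has_real_derivative pdx f (x, y)) (at x)"
  and smooth2_has_pdy:
    "((\<lambda>t. f (x, t)) has_real_derivative pdy f (x, y)) (at y)"
  if sm: "smooth2 f" for f
proof -
  obtain D where D: "D 0 0 = f" "\<And>i j. smooth2 (D i j)"
    "\<And>i j x y. ((\<lambda>t. D i j (t, y)) has_real_derivative D (Suc i) j (x, y)) (at x)"
    "\<And>i j x y. ((\<lambda>t. D i j (x, t)) has_real_derivative D i (Suc j) (x, y)) (at y)"
    "\<And>i j. continuous_on UNIV (D i j)"
    using smooth2_partials[OF sm] by blast
  have px: "pdx (D i j) = D (Suc i) j" and py: "pdy (D i j) = D i (Suc j)" for i j
    by (rule pdx_eqI pdy_eqI, fact D)+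
  show "smooth2 (pdx f)" "smooth2 (pdy f)" "pdx (pdy f) = pdy (pdx f)" "continuous_on UNIV f"
    "((\<lambda>t. f (t, y)) has_real_derivative pdx f (x, y)) (at x)"
    "((\<lambda>t. f (x, t)) has_real_derivative pdy f (x, y)) (at y)"
    using D(2-5) by (simp_all add: px py flip: D(1))
qed

lemma smooth2_linear:
  assumes "smooth2 f" "smooth2 g"
  shows "smooth2 (\<lambda>p. c * f p + d * g p)"
proof -
  obtain D where D: "D 0 0 = f" "\<And>i j p. (D i j has_derivative
        (\<lambda>h. D (Suc i) j p * fst h + D i (Suc j) p * snd h)) (at p)"
    using assms(1) unfolding smooth2_def by blast
  obtain E where E: "E 0 0 = g" "\<And>i j p. (E i j has_derivative
        (\<lambda>h. E (Suc i) j p * fst h + E i (Suc j) p * snd h)) (at p)"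
    using assms(2) unfolding smooth2_def by blast
  show ?thesis
    unfolding smooth2_def
    by (rule exI[of _ "\<lambda>i j p. c * D i j p + d * E i j p"])
       (auto simp: D(1) E(1) algebra_simps intro!: derivative_eq_intros D(2) E(2))
qed

lemma pdx_linear:
  assumes "smooth2 f" "smooth2 g"
  shows "pdx (\<lambda>p. c * f p + d * g p) = (\<lambda>p. c * pdx f p + d * pdx g p)"
  by (rule pdx_eqI) (auto intro!: derivative_eq_intros smooth2_has_pdx assms)

lemma pdy_linear:
  assumes "smooth2 f" "smooth2 g"
  shows "pdy (\<lambda>p. c * f p + d * g p) = (\<lambda>p. c * pdy f p + d * pdy g p)"
  by (rule pdy_eqI) (auto intro!: derivative_eq_intros smooth2_has_pdy assms)

text \<open>The engine for the structure equations of the immersion: each relation between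
  derivatives comes from differentiating a constant inner product.\<close>

lemma dx_ip_const:
  assumes "\<And>i. i \<le> n \<Longrightarrow> smooth2 (u i)" "\<And>i. i \<le> n \<Longrightarrow> smooth2 (v i)"
    and "\<And>p. ip n (at_pt u p) (at_pt v p) = c"
  shows "ip n (at_pt (dx u) p) (at_pt v p) + ip n (at_pt u p) (at_pt (dx v) p) = 0"
proof -
  obtain x y where p: "p = (x, y)" by fastforce
  have "((\<lambda>t. ip n (at_pt u (t, y)) (at_pt v (t, y))) has_real_derivative
      (\<Sum>i\<le>n. pdx (u i) (x, y) * v i (x, y) + u i (x, y) * pdx (v i) (x, y))) (at x)"
    unfolding ip_def at_pt_def
    by (rule DERIV_sum)
      (auto intro!: derivative_eq_intros smooth2_has_pdx assms(1,2) simp: algebra_simps)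
  then have "(\<Sum>i\<le>n. pdx (u i) (x, y) * v i (x, y) + u i (x, y) * pdx (v i) (x, y)) = 0"
    unfolding assms(3) using DERIV_const DERIV_unique by blast
  then show ?thesis
    by (simp add: p ip_def at_pt_def dx_def sum.distrib)
qed

lemma dy_ip_const:
  assumes "\<And>i. i \<le> n \<Longrightarrow> smooth2 (u i)" "\<And>i. i \<le> n \<Longrightarrow> smooth2 (v i)"
    and "\<And>p. ip n (at_pt u p) (at_pt v p) = c"
  shows "ip n (at_pt (dy u) p) (at_pt v p) + ip n (at_pt u p) (at_pt (dy v) p) = 0"
proof -
  obtain x y where p: "p = (x, y)" by fastforce
  have "((\<lambda>t. ip n (at_pt u (x, t)) (at_pt v (x, t))) has_real_derivative
      (\<Sum>i\<le>n. pdy (u i) (x, y) * v i (x, y) + u i (x, y) * pdy (v i) (x, y))) (at y)"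
    unfolding ip_def at_pt_def
    by (rule DERIV_sum)
      (auto intro!: derivative_eq_intros smooth2_has_pdy assms(1,2) simp: algebra_simps)
  then have "(\<Sum>i\<le>n. pdy (u i) (x, y) * v i (x, y) + u i (x, y) * pdy (v i) (x, y)) = 0"
    unfolding assms(3) using DERIV_const DERIV_unique by blast
  then show ?thesis
    by (simp add: p ip_def at_pt_def dy_def sum.distrib)
qed

section \<open>Linear algebra in finitely many real coordinates\<close>

lemma underdetermined_system:
  fixes u :: "'i \<Rightarrow> 'e \<Rightarrow> real"
  assumes "finite E" "finite I" "card E < card I"
  shows "\<exists>c. (\<exists>i\<in>I. c i \<noteq> 0) \<and> (\<forall>e\<in>E. (\<Sum>i\<in>I. c i * u i e) = 0)"
  using assms
proof (induction E arbitrary: I u rule: finite_induct)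
  case empty
  then obtain i where "i \<in> I" by fastforce
  then show ?case by (intro exI[of _ "\<lambda>_. 1"]) auto
next
  case (insert e E)
  show ?case
  proof (cases "\<forall>i\<in>I. u i e = 0")
    case True
    have "card E < card I" using insert by simp
    with insert obtain c where "\<exists>i\<in>I. c i \<noteq> 0" "\<forall>e\<in>E. (\<Sum>i\<in>I. c i * u i e) = 0" by blast
    with True show ?thesis by (intro exI[of _ c]) simp
  next
    case False
    then obtain j where j: "j \<in> I" "u j e \<noteq> 0" by blast
    define J where "J = I - {j}"
    have J: "finite J" "card E < card J" "j \<notin> J" "I = insert j J"
      using insert j by (auto simp: J_def)
    \<comment> \<open>Gaussian elimination with pivot \<open>j\<close>: subtracting multiples of
      \<open>u j\<close> removes the coordinate \<open>e\<close>. The coefficient of the pivot is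
      restored in \<open>d\<close> so that the equation for \<open>e\<close> holds too.\<close>
    define w where "w i e' = u i e' - u i e / u j e * u j e'" for i e'
    from insert.IH[OF J(1,2), of w] obtain c where
      c: "\<exists>i\<in>J. c i \<noteq> 0" "\<And>e'. e' \<in> E \<Longrightarrow> (\<Sum>i\<in>J. c i * w i e') = 0" by blast
    define s where "s = (\<Sum>i\<in>J. c i * u i e)"
    define d where "d = c(j := - s / u j e)"
    have dJ: "(\<Sum>i\<in>J. d i * u i e') = (\<Sum>i\<in>J. c i * u i e')" for e'
      using J(3) by (intro sum.cong) (auto simp: d_def)
    have "(\<Sum>i\<in>I. d i * u i e') = 0" if "e' \<in> insert e E" for e'
    proof -
      have eq: "(\<Sum>i\<in>I. d i * u i e') = (\<Sum>i\<in>J. c i * u i e') - s / u j e * u j e'"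
        using J by (simp add: dJ) (simp add: d_def)
      also have "\<dots> = (\<Sum>i\<in>J. c i * w i e')"
        by (simp add: w_def s_def algebra_simps sum_subtractf sum_distrib_left sum_distrib_right
            sum_divide_distrib)
      finally show ?thesis
        using that eq j(2) c(2) by (auto simp: s_def)
    qed
    moreover have "\<exists>i\<in>I. d i \<noteq> 0"
      using c(1) J by (auto simp: d_def)
    ultimately show ?thesis by blast
  qed
qed

text \<open>The remainder \<open>w\<close> of the expansion of \<open>u\<close> is orthogonal to all
  \<open>e j\<close>. The n + 2 vectors consisting of the \<open>e j\<close> and \<open>w\<close>
  have n + 1 coordinates, hence are dependent; pairing the relation with each \<open>e k\<close>
  kills its coefficient, so \<open>w\<close> itself vanishes in all pairings.\<close>

lemma orthonormal_parseval:
  fixes e :: "nat \<Rightarrow> nat \<Rightarrow> real"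
  assumes "\<And>j k. j \<le> n \<Longrightarrow> k \<le> n \<Longrightarrow> ip n (e j) (e k) = (if j = k then 1 else 0)"
  shows "ip n u v = (\<Sum>j\<le>n. ip n u (e j) * ip n v (e j))"
proof -
  define w where "w i = u i - (\<Sum>j\<le>n. ip n u (e j) * e j i)" for i
  have ips: "ip n (\<lambda>i. \<Sum>j\<le>n. c j * e j i) x = (\<Sum>j\<le>n. c j * ip n (e j) x)" for c x
    unfolding ip_def sum_distrib_right sum_distrib_left by (subst sum.swap) (simp add: mult_ac)
  have ortho: "(\<Sum>j\<le>n. c j * ip n (e j) (e k)) = c k" if "k \<le> n" for c k
    using that assms by (simp add: if_distrib[of "(*) _"] cong: if_cong)
  have wd: "ip n w x = ip n u x - (\<Sum>j\<le>n. ip n u (e j) * ip n (e j) x)" for x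
    by (simp add: w_def ip_def[of n w] left_diff_distrib sum_subtractf flip: ips)
       (simp add: ip_def)
  have we: "ip n w (e k) = 0" if "k \<le> n" for k
    using that by (simp add: wd ortho)
  define f where "f j = (if j \<le> n then e j else w)" for j
  obtain c where c: "\<exists>i\<in>{..Suc n}. c i \<noteq> 0"
    "\<And>i. i \<le> n \<Longrightarrow> (\<Sum>j\<le>Suc n. c j * f j i) = 0"
    using underdetermined_system[of "{..n}" "{..Suc n}" f] by auto
  have rel: "(\<Sum>j\<le>n. c j * e j i) = - c (Suc n) * w i" if "i \<le> n" for i
    using c(2)[OF that] by (simp add: f_def)
  have relx: "(\<Sum>j\<le>n. c j * ip n (e j) x) = - c (Suc n) * ip n w x" for x
  proof -
    have "(\<Sum>j\<le>n. c j * ip n (e j) x) = ip n (\<lambda>i. \<Sum>j\<le>n. c j * e j i) x"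
      by (simp add: ips)
    also have "\<dots> = (\<Sum>i\<le>n. (- c (Suc n) * w i) * x i)"
      unfolding ip_def by (intro sum.cong) (auto simp: rel)
    also have "\<dots> = - c (Suc n) * ip n w x"
      unfolding ip_def sum_distrib_left by (simp add: mult.assoc)
    finally show ?thesis .
  qed
  have c0: "c k = 0" if "k \<le> n" for k
    using relx[of "e k"] that by (simp add: ortho we)
  with c(1) have "c (Suc n) \<noteq> 0"
    by (auto simp: le_Suc_eq)
  moreover have "c (Suc n) * ip n w v = 0"
    using relx[of v] c0 by simp
  ultimately have "ip n w v = 0" by simp
  then show ?thesis
    using wd[of v] by (simp add: ip_def mult_ac)
qed

section \<open>Fourier analysis on the square torus\<close>

text \<open>Powers of K concentrate where K = 1: on the cell, f K^n is at least r^n g - M \<rho>^n with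
  \<rho> < r and g = max f 0 * max (K - r) 0, whose integral is positive.\<close>

lemma integral_power_peak_pos:
  fixes f K :: "'a::euclidean_space \<Rightarrow> real"
  assumes f: "continuous_on (cbox a b) f" and K: "continuous_on (cbox a b) K"
    and K01: "\<And>z. z \<in> cbox a b \<Longrightarrow> 0 \<le> K z \<and> K z \<le> 1"
    and z0: "z0 \<in> cbox a b" "K z0 = 1" and ne: "box a b \<noteq> {}"
    and peak: "\<And>z. z \<in> cbox a b \<Longrightarrow> K z = 1 \<Longrightarrow> 0 < f z"
  shows "\<exists>n. 0 < integral (cbox a b) (\<lambda>z. f z * K z ^ n)"
proof -
  obtain M where M: "\<And>z. z \<in> cbox a b \<Longrightarrow> \<bar>f z\<bar> \<le> M" "0 < M"
  proof -
    have "bounded (f ` cbox a b)"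
      by (intro compact_imp_bounded compact_continuous_image f compact_cbox)
    then show thesis using that by (auto simp: bounded_pos)
  qed
  define Z where "Z = {z \<in> cbox a b. f z \<le> 0}"
  have "compact Z"
  proof -
    have "closed (cbox a b \<inter> f -` {..0})"
      by (intro continuous_closed_preimage f closed_cbox closed_atMost)
    moreover have "Z = cbox a b \<inter> (cbox a b \<inter> f -` {..0})" by (auto simp: Z_def)
    ultimately show ?thesis using compact_Int_closed[OF compact_cbox] by metis
  qed
  \<comment> \<open>On the compact set \<open>Z\<close> the maximum of \<open>K\<close> is attained,
    and it is below 1 because \<open>f\<close> is positive wherever \<open>K\<close> is 1. The value
    1/2 keeps \<open>\<rho>\<close> positive.\<close>
  have "\<exists>\<rho>. 0 < \<rho> \<and> \<rho> < 1 \<and> (\<forall>z\<in>Z. K z \<le> \<rho>)"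
  proof (cases "Z = {}")
    case True
    then show ?thesis by (intro exI[of _ "1/2"]) simp
  next
    case False
    have "continuous_on Z K" using K by (rule continuous_on_subset) (auto simp: Z_def)
    from continuous_attains_sup[OF \<open>compact Z\<close> False this] obtain w
      where w: "w \<in> Z" "\<And>z. z \<in> Z \<Longrightarrow> K z \<le> K w" by blast
    have "w \<in> cbox a b" "f w \<le> 0" using w(1) by (auto simp: Z_def)
    then have "K w < 1" using peak[of w] K01[of w] by fastforce
    with w show ?thesis
      by (intro exI[of _ "max (K w) (1/2)"]) (auto intro: max.coboundedI1)
  qed
  then obtain \<rho> where \<rho>: "0 < \<rho>" "\<rho> < 1" "\<And>z. z \<in> Z \<Longrightarrow> K z \<le> \<rho>" by blast
  define r where "r = (1 + \<rho>) / 2"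
  have r: "\<rho> < r" "r < 1" "0 < r" using \<rho> by (auto simp: r_def)
  define g where "g z = max (f z) 0 * max (K z - r) 0" for z
  have g: "continuous_on (cbox a b) g"
    unfolding g_def by (intro continuous_intros f K)
  define G where "G = integral (cbox a b) g"
  have "g z0 > 0" using z0 r peak by (auto simp: g_def)
  have "G \<noteq> 0"
  proof
    assume "G = 0"
    then have "(g has_integral 0) (cbox a b)"
      unfolding G_def using integrable_continuous[OF g] by (metis integrable_integral)
    \<comment> \<open>The point \<open>z0\<close> may lie on the boundary of the box; nonempty
      interior and continuity still force the value 0 there.\<close>
    then have "g z0 = 0"
      using has_integral_0_cbox_imp_0[OF g _ _ ne z0(1)] by (simp add: g_def)
    with \<open>g z0 > 0\<close> show False by simp
  qed
  moreover have "0 \<le> G"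
    unfolding G_def by (rule integral_nonneg[OF integrable_continuous[OF g]]) (simp add: g_def)
  ultimately have "0 < G" by simp
  define C where "C = measure lborel (cbox a b)"
  have "C \<ge> 0" by (simp add: C_def)
  have low: "r ^ n * g z - M * \<rho> ^ n \<le> f z * K z ^ n" if z: "z \<in> cbox a b" for z n
  proof (cases "f z \<le> 0")
    case True
    then have "z \<in> Z" using z by (simp add: Z_def)
    have "- f z * K z ^ n \<le> M * \<rho> ^ n"
      using M(1)[OF z] M(2) \<rho>(3)[OF \<open>z \<in> Z\<close>] K01[OF z] True
      by (intro mult_mono power_mono) auto
    with True show ?thesis by (simp add: g_def)
  next
    case False
    have "r ^ n * max (K z - r) 0 \<le> K z ^ n"
    proof (cases "K z \<le> r")
      case True
      then show ?thesis using K01[OF z] by simp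
    next
      case False
      then have "r ^ n * max (K z - r) 0 \<le> K z ^ n * 1"
        using K01[OF z] r by (intro mult_mono power_mono) auto
      then show ?thesis by simp
    qed
    then have "f z * (r ^ n * max (K z - r) 0) \<le> f z * K z ^ n"
      using False by (intro mult_left_mono) auto
    moreover have "0 \<le> M * \<rho> ^ n" using M(2) \<rho>(1) by simp
    moreover have "r ^ n * g z = f z * (r ^ n * max (K z - r) 0)"
      using False by (simp add: g_def)
    ultimately show ?thesis by linarith
  qed
  have int: "r ^ n * G - M * \<rho> ^ n * C \<le> integral (cbox a b) (\<lambda>z. f z * K z ^ n)" for n
  proof -
    have "integral (cbox a b) (\<lambda>z. r ^ n * g z - M * \<rho> ^ n) \<le> integral (cbox a b) (\<lambda>z. f z * K z ^ n)"
      by (intro integral_le integrable_continuous continuous_intros f K g low)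
    moreover have "integral (cbox a b) (\<lambda>z. r ^ n * g z - M * \<rho> ^ n) = r ^ n * G - M * \<rho> ^ n * C"
      by (subst integral_diff)
        (auto simp: G_def C_def intro!: integrable_continuous continuous_intros g)
    ultimately show ?thesis by simp
  qed
  have "(\<lambda>n. (\<rho> / r) ^ n) \<longlonglongrightarrow> 0"
    using \<rho> r by (intro LIMSEQ_power_zero) (simp add: abs_of_pos)
  then have "(\<lambda>n. M * C * (\<rho> / r) ^ n) \<longlonglongrightarrow> M * C * 0" by (rule tendsto_mult_left)
  then have "(\<lambda>n. M * C * (\<rho> / r) ^ n) \<longlonglongrightarrow> 0" by simp
  from order_tendstoD(2)[OF this \<open>0 < G\<close>] obtain n where "M * C * (\<rho> / r) ^ n < G"
    by (auto simp: eventually_sequentially)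
  then have "0 < r ^ n * G - M * \<rho> ^ n * C"
    using r by (simp add: power_divide field_simps)
  with int[of n] show ?thesis by (intro exI[of _ n]) linarith
qed

definition phase :: "real \<Rightarrow> int \<times> int \<Rightarrow> real \<times> real \<Rightarrow> real" where
  "phase a v p = (of_int (fst v) * fst p + of_int (snd v) * snd p) / a"

abbreviation fund_square :: "real \<Rightarrow> (real \<times> real) set" where
  "fund_square a \<equiv> cbox (0, 0) (2 * pi * a, 2 * pi * a)"

lemma continuous_phase [continuous_intros]:
  "continuous_on S f \<Longrightarrow> continuous_on S (\<lambda>x. phase a v (f x))"
  unfolding phase_def divide_inverse by (intro continuous_intros)

lemma periodic_int:
  fixes f :: "real \<Rightarrow> 'a"
  assumes "\<And>x. f (x + P) = f x"
  shows "f (x + of_int k * P) = f x"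
proof (induction k rule: int_induct[of _ 0])
  case (step1 i)
  then show ?case using assms[of "x + of_int i * P"] by (simp add: algebra_simps)
next
  case (step2 i)
  then show ?case using assms[of "x + of_int (i - 1) * P"] by (simp add: algebra_simps)
qed simp

text \<open>Multiplying a character by the peak function K shifts its frequency by unit vectors, so a function
  orthogonal to all characters is orthogonal to all powers of K.\<close>

lemma fourier_uniqueness:
  assumes a: "a > 0" and f: "continuous_on UNIV f"
    and per: "\<And>x y. f (x + 2 * pi * a, y) = f (x, y)" "\<And>x y. f (x, y + 2 * pi * a) = f (x, y)"
    and orth: "\<And>v c. integral (fund_square a) (\<lambda>p. f p * cos (phase a v p + c)) = 0"
  shows "f p = (0::real)"
proof -
  \<comment> \<open>The peak argument excludes positive values only. The hypotheses are restated for
    an arbitrary \<open>f\<close> so that the bound also applies to the negative function.\<close>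
  have nonpos: "f z \<le> 0" if f: "continuous_on UNIV f"
    and per: "\<And>x y. f (x + 2 * pi * a, y) = f (x, y)" "\<And>x y. f (x, y + 2 * pi * a) = f (x, y)"
    and orth: "\<And>v c. integral (fund_square a) (\<lambda>p. f p * cos (phase a v p + c)) = 0"
    for f :: "real \<times> real \<Rightarrow> real" and z
  proof (rule ccontr)
    assume pos: "\<not> f z \<le> 0"
    define P where "P = 2 * pi * a"
    have P: "P > 0" using a by (simp add: P_def)
    have pers: "f (x + of_int j * P, y + of_int k * P) = f (x, y)" for x y j k
      using periodic_int[of "\<lambda>x. f (x, y + of_int k * P)" P x j] periodic_int[of "\<lambda>y. f (x, y)" P y k]
        per by (simp add: P_def)
    define x0 where "x0 = fst z + of_int (- \<lfloor>fst z / P\<rfloor>) * P"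
    define y0 where "y0 = snd z + of_int (- \<lfloor>snd z / P\<rfloor>) * P"
    have fx0: "f (x0, y0) > 0"
      using pos unfolding x0_def y0_def pers by simp
    have red: "0 \<le> t + of_int (- \<lfloor>t / P\<rfloor>) * P \<and> t + of_int (- \<lfloor>t / P\<rfloor>) * P \<le> P" for t
    proof -
      have "of_int \<lfloor>t / P\<rfloor> * P \<le> t"
        using P by (simp add: pos_le_divide_eq[symmetric])
      moreover have "t \<le> (of_int \<lfloor>t / P\<rfloor> + 1) * P"
        unfolding pos_divide_le_eq[OF P, symmetric] by linarith
      ultimately show ?thesis by (simp add: algebra_simps)
    qed
    have z0: "(x0, y0) \<in> fund_square a"
      using red by (auto simp: x0_def y0_def P_def[symmetric] cbox_Pair_eq simp del: of_int_minus)
    \<comment> \<open>A trigonometric polynomial with values in [0, 1], equal to 1 exactly at the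
      lattice translates of \<open>(x0, y0)\<close>, where periodicity gives \<open>f\<close> the
      same positive value.\<close>
    define K where "K p = (2 + cos ((fst p - x0) / a) + cos ((snd p - y0) / a)) / 4" for p
    have Kc: "continuous_on S K" for S
      unfolding K_def divide_inverse by (intro continuous_intros)
    have peak: "0 < f q" if "K q = 1" for q
    proof -
      have "cos ((fst q - x0) / a) + cos ((snd q - y0) / a) = 2"
        using that by (simp add: K_def)
      then have "cos ((fst q - x0) / a) = 1 \<and> cos ((snd q - y0) / a) = 1"
        using cos_le_one[of "(fst q - x0) / a"] cos_le_one[of "(snd q - y0) / a"] by linarith
      then obtain j k :: int where "(fst q - x0) / a = of_int j * 2 * pi"
          "(snd q - y0) / a = of_int k * 2 * pi"
        unfolding cos_one_2pi_int by blast
      then have "q = (x0 + of_int j * P, y0 + of_int k * P)"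
        using a by (simp add: P_def prod_eq_iff field_simps)
      then show ?thesis using pers fx0 by simp
    qed
    \<comment> \<open>The offset \<open>c\<close> is generalised together with \<open>v\<close>: it
      absorbs the position \<open>x0 / a\<close>, \<open>y0 / a\<close> of the peak at every
      step.\<close>
    have "integral (fund_square a) (\<lambda>p. f p * K p ^ n * cos (phase a v p + c)) = 0" for n v c
    proof (induction n arbitrary: v c)
      case 0
      then show ?case using orth by simp
    next
      case (Suc n)
      let ?J = "\<lambda>w d. integral (fund_square a) (\<lambda>p. f p * K p ^ n * cos (phase a w p + d))"
      have ci: "(\<lambda>p. f p * K p ^ n * cos (phase a w p + d)) integrable_on fund_square a" for w d
        by (intro integrable_continuous continuous_intros Kc continuous_on_subset[OF f]) auto
      have pr: "cos s * cos t = (cos (t + s) + cos (t - s)) / 2" for s t :: real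
        by (simp add: cos_add cos_diff)
      have x1: "phase a v p + c + (fst p - x0) / a = phase a (v + (1, 0)) p + (c - x0 / a)"
        and x2: "phase a v p + c - (fst p - x0) / a = phase a (v - (1, 0)) p + (c + x0 / a)"
        and y1: "phase a v p + c + (snd p - y0) / a = phase a (v + (0, 1)) p + (c - y0 / a)"
        and y2: "phase a v p + c - (snd p - y0) / a = phase a (v - (0, 1)) p + (c + y0 / a)" for p
        using a by (auto simp: phase_def field_simps)
      \<comment> \<open>The constant term 2/4 of \<open>K\<close> keeps the frequency, with weight
        1/2; each cosine of weight 1/4 splits into two shifted cosines of weight 1/8.\<close>
      have "K p * cos (phase a v p + c) = cos (phase a v p + c) / 2
          + cos (phase a (v + (1, 0)) p + (c - x0 / a)) / 8
          + cos (phase a (v - (1, 0)) p + (c + x0 / a)) / 8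
          + cos (phase a (v + (0, 1)) p + (c - y0 / a)) / 8
          + cos (phase a (v - (0, 1)) p + (c + y0 / a)) / 8" for p
        unfolding K_def x1[symmetric] x2[symmetric] y1[symmetric] y2[symmetric]
        by (simp add: pr add_divide_distrib distrib_right)
      then have eq: "f p * K p ^ Suc n * cos (phase a v p + c) =
          f p * K p ^ n * cos (phase a v p + c) / 2
          + f p * K p ^ n * cos (phase a (v + (1, 0)) p + (c - x0 / a)) / 8
          + f p * K p ^ n * cos (phase a (v - (1, 0)) p + (c + x0 / a)) / 8
          + f p * K p ^ n * cos (phase a (v + (0, 1)) p + (c - y0 / a)) / 8
          + f p * K p ^ n * cos (phase a (v - (0, 1)) p + (c + y0 / a)) / 8" for p
        by (simp add: mult.assoc mult.left_commute[of "K p"] distrib_left)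
      have "((\<lambda>p. f p * K p ^ Suc n * cos (phase a v p + c)) has_integral
          (?J v c / 2 + ?J (v + (1, 0)) (c - x0 / a) / 8 + ?J (v - (1, 0)) (c + x0 / a) / 8
            + ?J (v + (0, 1)) (c - y0 / a) / 8 + ?J (v - (0, 1)) (c + y0 / a) / 8)) (fund_square a)"
        unfolding eq by (intro has_integral_add has_integral_divide integrable_integral ci)
      then show ?case using Suc.IH by (simp add: integral_unique)
    qed
    from this[of _ "(0, 0)" 0] have "integral (fund_square a) (\<lambda>p. f p * K p ^ n) = 0" for n
      by (simp add: phase_def)
    moreover have "\<exists>n. 0 < integral (fund_square a) (\<lambda>p. f p * K p ^ n)"
    proof (rule integral_power_peak_pos[where ?z0.0 = "(x0, y0)"])
      have bd: "-1 \<le> s \<Longrightarrow> s \<le> 1 \<Longrightarrow> -1 \<le> t \<Longrightarrow> t \<le> 1 \<Longrightarrow> 0 \<le> (2 + s + t) / 4 \<and> (2 + s + t) / 4 \<le> 1"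
        for s t :: real by simp
      show "0 \<le> K q \<and> K q \<le> 1" for q
        unfolding K_def
        by (rule bd[OF cos_ge_minus_one cos_le_one cos_ge_minus_one cos_le_one])
      show "box (0, 0) (2 * pi * a, 2 * pi * a) \<noteq> {}"
        using a by (auto simp: box_ne_empty Basis_prod_def)
      show "continuous_on (fund_square a) f" using f by (rule continuous_on_subset) simp
      show "K (x0, y0) = 1" by (simp add: K_def)
      show "0 < f q" if "K q = 1" for q using that by (rule peak)
    qed (fact z0 Kc)+
    ultimately show False by (metis less_irrefl)
  qed
  have "f p \<le> 0" by (rule nonpos[OF f per orth])
  moreover have "- f p \<le> 0"
  proof (rule nonpos[of "\<lambda>q. - f q"])
    show "integral (fund_square a) (\<lambda>p. - f p * cos (phase a v p + c)) = 0" for v c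
      by (simp only: mult_minus_left integral_neg orth minus_zero)
    show "continuous_on UNIV (\<lambda>q. - f q)" by (intro continuous_on_minus f)
    show "- f (x + 2 * pi * a, y) = - f (x, y)" "- f (x, y + 2 * pi * a) = - f (x, y)" for x y
      by (simp_all only: per)
  qed
  ultimately show ?thesis by linarith
qed

section \<open>Integration by parts on the torus and orthogonality of characters\<close>

lemma integral_pdx_periodic:
  assumes a: "a > 0" and W: "\<And>x y. ((\<lambda>t. W (t, y)) has_real_derivative w (x, y)) (at x)"
    and w: "continuous_on UNIV w" and per: "\<And>x y. W (x + 2 * pi * a, y) = W (x, y)"
  shows "integral (fund_square a) w = 0"
proof -
  let ?P = "2 * pi * a"
  have c: "continuous_on (fund_square a) w" using w by (rule continuous_on_subset) simp
  have "integral (cbox 0 ?P) (\<lambda>x. w (x, y)) = 0" for y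
  proof -
    have "((\<lambda>x. w (x, y)) has_integral (W (?P, y) - W (0, y))) {0..?P}"
      using a by (intro fundamental_theorem_of_calculus)
        (auto intro: has_field_derivative_at_within W simp flip: has_real_derivative_iff_has_vector_derivative)
    with per[of 0 y] show ?thesis by (auto simp: integral_unique)
  qed
  \<comment> \<open>The product formula integrates over the second coordinate inside, so the order
    is swapped to expose the vanishing integrals in x.\<close>
  moreover have "integral (fund_square a) w = integral (cbox 0 ?P) (\<lambda>y. integral (cbox 0 ?P) (\<lambda>x. w (x, y)))"
    using integral_swap_continuous[of 0 0 ?P ?P "\<lambda>x y. w (x, y)"] integral_prod_continuous[OF c] c
    by (simp add: case_prod_beta)
  ultimately show ?thesis by simp
qed

lemma integral_pdy_periodic:
  assumes a: "a > 0" and W: "\<And>x y. ((\<lambda>t. W (x, t)) has_real_derivative w (x, y)) (at y)"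
    and w: "continuous_on UNIV w" and per: "\<And>x y. W (x, y + 2 * pi * a) = W (x, y)"
  shows "integral (fund_square a) w = 0"
proof -
  let ?P = "2 * pi * a"
  have c: "continuous_on (fund_square a) w" using w by (rule continuous_on_subset) simp
  have "integral (cbox 0 ?P) (\<lambda>y. w (x, y)) = 0" for x
  proof -
    have "((\<lambda>y. w (x, y)) has_integral (W (x, ?P) - W (x, 0))) {0..?P}"
      using a by (intro fundamental_theorem_of_calculus)
        (auto intro: has_field_derivative_at_within W simp flip: has_real_derivative_iff_has_vector_derivative)
    with per[of x 0] show ?thesis by (auto simp: integral_unique)
  qed
  then show ?thesis using integral_prod_continuous[OF c] by simp
qed

lemma smooth2_const: "smooth2 (\<lambda>_. c)"
  unfolding smooth2_def
  by (rule exI[of _ "\<lambda>i j p. if i = 0 \<and> j = 0 then c else 0"]) (auto simp: fun_eq_iff)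

lemma phase_periodic:
  assumes "a \<noteq> 0"
  shows "phase a v (x + 2 * pi * a, y) = phase a v (x, y) + 2 * pi * of_int (fst v)"
    and "phase a v (x, y + 2 * pi * a) = phase a v (x, y) + 2 * pi * of_int (snd v)"
  using assms by (simp_all add: phase_def field_simps)

lemma sin_cos_add_int_period:
  "cos (x + 2 * pi * of_int k + c) = cos (x + c)" "sin (x + 2 * pi * of_int k + c) = sin (x + c)"
proof -
  have "x + 2 * pi * of_int k + c = (x + c) + 2 * pi * of_int k" by simp
  then show "cos (x + 2 * pi * of_int k + c) = cos (x + c)" "sin (x + 2 * pi * of_int k + c) = sin (x + c)"
    by (simp_all only: cos_add sin_add cos_int_2pin sin_int_2pin) simp_all
qed

lemma phase_has_derivative:
  "((\<lambda>t. phase a v (t, y)) has_real_derivative of_int (fst v) / a) (at x)"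
  "((\<lambda>t. phase a v (x, t)) has_real_derivative of_int (snd v) / a) (at y)"
  unfolding phase_def divide_inverse by (auto intro!: derivative_eq_intros)

lemma pdx_periodic:
  assumes "smooth2 f" "\<And>x y. f (x + P, y) = f (x, y)"
  shows "pdx f (x + P, y) = pdx f (x, y)"
proof -
  have "((\<lambda>t. f (t + P, y)) has_real_derivative pdx f (x + P, y)) (at x)"
    using smooth2_has_pdx[OF assms(1), of y "x + P"] by (simp add: DERIV_shift)
  then show ?thesis
    using smooth2_has_pdx[OF assms(1), of y x] DERIV_unique by (simp add: assms(2)) blast
qed

lemma pdy_periodic:
  assumes "smooth2 f" "\<And>x y. f (x, y + P) = f (x, y)"
  shows "pdy f (x, y + P) = pdy f (x, y)"
proof -
  have "((\<lambda>t. f (x, t + P)) has_real_derivative pdy f (x, y + P)) (at y)"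
    using smooth2_has_pdy[OF assms(1), of x "y + P"] by (simp add: DERIV_shift)
  then show ?thesis
    using smooth2_has_pdy[OF assms(1), of x y] DERIV_unique by (simp add: assms(2)) blast
qed

text \<open>Self-adjointness of the Laplacian: integrating by parts shows that the difference of the
  two eigenvalues times the integral is 0. The free offset \<open>c\<close> treats cosine and sine
  at once.\<close>

lemma eigenfunction_fourier_coeff:
  assumes a: "a > 0" and f: "smooth2 f"
    and per: "\<And>x y. f (x + 2 * pi * a, y) = f (x, y)" "\<And>x y. f (x, y + 2 * pi * a) = f (x, y)"
    and eig: "\<And>p. pdx (pdx f) p + pdy (pdy f) p = - \<mu> * f p"
    and v: "of_int ((fst v)\<^sup>2 + (snd v)\<^sup>2) \<noteq> \<mu> * a\<^sup>2"
  shows "integral (fund_square a) (\<lambda>p. f p * cos (phase a v p + c)) = 0"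
proof -
  let ?k = "of_int (fst v) / a :: real" and ?l = "of_int (snd v) / a :: real"
  let ?C = "\<lambda>p. cos (phase a v p + c)" and ?S = "\<lambda>p. sin (phase a v p + c)"
  have a0: "a \<noteq> 0" using a by simp
  have wx: "integral (fund_square a) (\<lambda>p. pdx (pdx f) p * ?C p + ?k\<^sup>2 * (f p * ?C p)) = 0"
  \<comment> \<open>This primitive is chosen so that the mixed terms, \<open>pdx f\<close> times the
    sine, cancel on differentiation.\<close>
  proof (rule integral_pdx_periodic[OF a, where W = "\<lambda>p. pdx f p * ?C p + ?k * f p * ?S p"])
    show "((\<lambda>t. pdx f (t, y) * ?C (t, y) + ?k * f (t, y) * ?S (t, y)) has_real_derivative
        pdx (pdx f) (x, y) * ?C (x, y) + ?k\<^sup>2 * (f (x, y) * ?C (x, y))) (at x)" for x y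
      by (rule derivative_eq_intros smooth2_has_pdx phase_has_derivative f smooth2_pdx refl)+
        (simp add: algebra_simps power2_eq_square)
    show "continuous_on UNIV (\<lambda>p. pdx (pdx f) p * ?C p + ?k\<^sup>2 * (f p * ?C p))"
      by (intro continuous_intros smooth2_continuous smooth2_pdx f)
  qed (simp add: phase_periodic[OF a0] sin_cos_add_int_period per pdx_periodic[OF f per(1)])
  have wy: "integral (fund_square a) (\<lambda>p. pdy (pdy f) p * ?C p + ?l\<^sup>2 * (f p * ?C p)) = 0"
  proof (rule integral_pdy_periodic[OF a, where W = "\<lambda>p. pdy f p * ?C p + ?l * f p * ?S p"])
    show "((\<lambda>t. pdy f (x, t) * ?C (x, t) + ?l * f (x, t) * ?S (x, t)) has_real_derivative
        pdy (pdy f) (x, y) * ?C (x, y) + ?l\<^sup>2 * (f (x, y) * ?C (x, y))) (at y)" for x y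
      by (rule derivative_eq_intros smooth2_has_pdy phase_has_derivative f smooth2_pdy refl)+
        (simp add: algebra_simps power2_eq_square)
    show "continuous_on UNIV (\<lambda>p. pdy (pdy f) p * ?C p + ?l\<^sup>2 * (f p * ?C p))"
      by (intro continuous_intros smooth2_continuous smooth2_pdy f)
  qed (simp add: phase_periodic[OF a0] sin_cos_add_int_period per pdy_periodic[OF f per(2)])
  have "integral (fund_square a) (\<lambda>p. (pdx (pdx f) p * ?C p + ?k\<^sup>2 * (f p * ?C p))
       + (pdy (pdy f) p * ?C p + ?l\<^sup>2 * (f p * ?C p))) = 0"
    by (subst integral_add)
      (simp_all add: wx wy, (intro integrable_continuous continuous_intros
        continuous_on_subset[OF smooth2_continuous] smooth2_pdx smooth2_pdy f subset_UNIV)+)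
  also have "(\<lambda>p. (pdx (pdx f) p * ?C p + ?k\<^sup>2 * (f p * ?C p))
       + (pdy (pdy f) p * ?C p + ?l\<^sup>2 * (f p * ?C p)))
     = (\<lambda>p. (?k\<^sup>2 + ?l\<^sup>2 - \<mu>) * (f p * ?C p))"
  proof
    fix p
    have "(pdx (pdx f) p * ?C p + ?k\<^sup>2 * (f p * ?C p)) + (pdy (pdy f) p * ?C p + ?l\<^sup>2 * (f p * ?C p))
      = (pdx (pdx f) p + pdy (pdy f) p) * ?C p + (?k\<^sup>2 + ?l\<^sup>2) * (f p * ?C p)"
      by (simp add: algebra_simps)
    also have "\<dots> = (?k\<^sup>2 + ?l\<^sup>2 - \<mu>) * (f p * ?C p)"
      unfolding eig by (simp add: algebra_simps)
    finally show "(pdx (pdx f) p * ?C p + ?k\<^sup>2 * (f p * ?C p)) + (pdy (pdy f) p * ?C p + ?l\<^sup>2 * (f p * ?C p))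
      = (?k\<^sup>2 + ?l\<^sup>2 - \<mu>) * (f p * ?C p)" .
  qed
  finally have "(?k\<^sup>2 + ?l\<^sup>2 - \<mu>) * integral (fund_square a) (\<lambda>p. f p * ?C p) = 0" by simp
  moreover have "?k\<^sup>2 + ?l\<^sup>2 - \<mu> \<noteq> 0"
    using v a by (auto simp: power_divide field_simps)
  ultimately show ?thesis by simp
qed

text \<open>The constant 1 is an eigenfunction for the eigenvalue 0, which belongs to no other
  frequency than (0, 0).\<close>

lemma integral_cos_phase:
  assumes "a > 0" "v \<noteq> (0, 0)"
  shows "integral (fund_square a) (\<lambda>p. cos (phase a v p + c)) = 0"
proof -
  have "(fst v)\<^sup>2 + (snd v)\<^sup>2 \<noteq> 0"
    using assms(2) by (simp add: sum_power2_eq_zero_iff prod_eq_iff)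
  then have ne: "real_of_int ((fst v)\<^sup>2 + (snd v)\<^sup>2) \<noteq> 0 * a\<^sup>2" by (simp del: of_int_add)
  have pd: "pdx (\<lambda>_. 1) = (\<lambda>_. 0)" "pdy (\<lambda>_. 1) = (\<lambda>_. 0)" "pdx (\<lambda>_. 0) = (\<lambda>_. 0)" "pdy (\<lambda>_. 0) = (\<lambda>_. 0)"
    by (auto intro!: pdx_eqI pdy_eqI)
  show ?thesis
    using eigenfunction_fourier_coeff[OF assms(1) smooth2_const[of 1] _ _ _ ne] pd by simp
qed

text \<open>The Hartley kernel. Its derivative at t is \<open>cas (- t)\<close>, and the squares of
  \<open>cas t\<close> and \<open>cas (- t)\<close> add up to 2; these two identities carry the
  computations for the explicit immersions.\<close>

definition cas :: "real \<Rightarrow> real" where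
  "cas t = cos t + sin t"

lemma cas_mult: "cas s * cas t = cos (s - t) + cos (s + t - pi / 2)"
  by (simp add: cas_def cos_diff sin_add algebra_simps)

lemma continuous_cas [continuous_intros]:
  fixes f :: "'a::t2_space \<Rightarrow> real"
  shows "continuous_on S f \<Longrightarrow> continuous_on S (\<lambda>x. cas (f x))"
  unfolding cas_def by (intro continuous_intros)

lemma integral_cas_cas:
  assumes a: "a > 0"
  shows "integral (fund_square a) (\<lambda>p. cas (phase a v p) * cas (phase a w p)) =
    (if v = w then (2 * pi * a)\<^sup>2 else 0)"
proof -
  have d: "phase a v p - phase a w p = phase a (v - w) p"
    and s: "phase a v p + phase a w p = phase a (v + w) p" for p
    by (simp_all add: phase_def diff_divide_distrib[symmetric] add_divide_distrib[symmetric] algebra_simps)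
  have int: "(\<lambda>p. cos (phase a u p + c)) integrable_on fund_square a" for u c
    by (intro integrable_continuous continuous_intros)
  have "integral (fund_square a) (\<lambda>p. cas (phase a v p) * cas (phase a w p)) =
      integral (fund_square a) (\<lambda>p. cos (phase a (v - w) p + 0))
      + integral (fund_square a) (\<lambda>p. cos (phase a (v + w) p + - (pi / 2)))"
    using integral_add[OF int[of "v - w" 0] int[of "v + w" "- (pi / 2)"]]
    by (simp add: cas_mult d s)
  moreover have "integral (fund_square a) (\<lambda>p. cos (phase a (v + w) p + - (pi / 2))) = 0"
  proof (cases "v + w = (0, 0)")
    \<comment> \<open>For opposite frequencies the integrand is the constant cos(- pi/2) = 0: the
      quarter-period offset makes \<open>cas\<close> at \<open>v\<close> and at \<open>- v\<close>
      orthogonal.\<close>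
    case True
    then show ?thesis by (simp add: phase_def)
  qed (use integral_cos_phase[OF a] in blast)
  moreover have "integral (fund_square a) (\<lambda>p. cos (phase a (v - w) p + 0)) =
     (if v = w then (2 * pi * a)\<^sup>2 else 0)"
  proof (cases "v = w")
    case True
    then show ?thesis using a by (simp add: phase_def content_Pair power2_eq_square)
  next
    case False
    then have "v - w \<noteq> (0, 0)" by (simp add: prod_eq_iff)
    with False show ?thesis using integral_cos_phase[OF a, of "v - w" 0] by simp
  qed
  ultimately show ?thesis by simp
qed

lemma cas_phase_independent:
  assumes a: "a > 0" and "finite F" and "\<And>p. (\<Sum>v\<in>F. c v * cas (phase a v p)) = 0" and w: "w \<in> F"
  shows "c w = 0"
proof -
  have "0 = integral (fund_square a) (\<lambda>p. (\<Sum>v\<in>F. c v * cas (phase a v p)) * cas (phase a w p))"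
    by (simp add: assms(3))
  also have "\<dots> = (\<Sum>v\<in>F. c v * integral (fund_square a) (\<lambda>p. cas (phase a v p) * cas (phase a w p)))"
    unfolding sum_distrib_right mult.assoc
    by (subst integral_sum)
      (auto intro!: assms(2) integrable_continuous continuous_intros)
  also have "\<dots> = c w * (2 * pi * a)\<^sup>2"
    using w assms(2) by (simp add: integral_cas_cas[OF a] if_distrib[of "(*) _"] cong: if_cong)
  finally show ?thesis using a by simp
qed

section \<open>Necessity\<close>

lemma finite_norm_level: "finite {w :: int \<times> int. (fst w)\<^sup>2 + (snd w)\<^sup>2 = m}"
proof (rule finite_subset)
  have le: "- (x\<^sup>2) \<le> x \<and> x \<le> x\<^sup>2" for x :: int
  proof (cases "x = 0")
    case False
    then have "\<bar>x\<bar> * 1 \<le> \<bar>x\<bar> * \<bar>x\<bar>" by (intro mult_left_mono) auto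
    then show ?thesis by (auto simp: power2_eq_square abs_le_iff simp flip: abs_mult)
  qed simp
  have "- m \<le> x \<and> x \<le> m \<and> - m \<le> y \<and> y \<le> m" if "x\<^sup>2 + y\<^sup>2 = m" for x y
    using that le[of x] le[of y] zero_le_power2[of x] zero_le_power2[of y] by linarith
  then show "{w :: int \<times> int. (fst w)\<^sup>2 + (snd w)\<^sup>2 = m} \<subseteq> {- m..m} \<times> {- m..m}" by auto
qed simp

lemma phase_uminus: "phase a (- v) p = - phase a v p"
  unfolding phase_def minus_divide_left by simp

lemma at_pt_apply: "at_pt V p i = V i p"
  by (simp add: at_pt_def)

lemma ip_commute: "ip n u v = ip n v u"
  by (simp add: ip_def mult.commute)

section \<open>Structure equations of a flat biharmonic surface in the sphere\<close>

context
  fixes a :: real and n :: nat and phi :: vmap and h :: real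
  assumes a: "a > 0" and imm: "torus_full_isometric_immersion a n phi"
    and bih: "biharmonic n phi" and mc: "\<And>p. mean_curv n phi p = h"
begin

abbreviation (input) "inn u v p \<equiv> ip n (at_pt u p) (at_pt v p)"

lemma phi_smooth:
  assumes "i \<le> n"
  shows "smooth2 (phi i)" "smooth2 (dx phi i)" "smooth2 (dy phi i)"
    "smooth2 (dx (dx phi) i)" "smooth2 (dy (dy phi) i)" "smooth2 (dy (dx phi) i)"
    and dx_dy_phi: "dx (dy phi) i = dy (dx phi) i"
  using imm assms
  by (simp_all add: torus_full_isometric_immersion_def dx_def dy_def pdx_pdy_commute)

lemma isometric_ips:
  shows phi_phi: "inn phi phi p = 1" and xx: "inn (dx phi) (dx phi) p = 1"
    and yy: "inn (dy phi) (dy phi) p = 1" and xy: "inn (dx phi) (dy phi) p = 0"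
  using imm unfolding torus_full_isometric_immersion_def by blast+

lemma inn_dx_dy_phi: "ip n u (at_pt (dx (dy phi)) p) = ip n u (at_pt (dy (dx phi)) p)"
  by (simp add: ip_def at_pt_def dx_dy_phi)

lemma phi_x: "inn phi (dx phi) p = 0"
  using dx_ip_const[OF phi_smooth(1) phi_smooth(1) phi_phi, where p = p] ip_commute[of n "at_pt phi p" "at_pt (dx phi) p"] by simp

lemma phi_y: "inn phi (dy phi) p = 0"
  using dy_ip_const[OF phi_smooth(1) phi_smooth(1) phi_phi, where p = p] ip_commute[of n "at_pt phi p" "at_pt (dy phi) p"] by simp

text \<open>In flat coordinates the Christoffel symbols vanish: second derivatives have no
  tangential part, and their components along \<open>phi\<close> are minus the metric
  coefficients.\<close>

lemma second_derivative_ips: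
  shows phi_xx: "inn phi (dx (dx phi)) p = -1" and phi_yy: "inn phi (dy (dy phi)) p = -1"
    and phi_xy: "inn phi (dy (dx phi)) p = 0"
    and x_xx: "inn (dx phi) (dx (dx phi)) p = 0" and x_xy: "inn (dx phi) (dy (dx phi)) p = 0"
    and y_yy: "inn (dy phi) (dy (dy phi)) p = 0" and y_xy: "inn (dy phi) (dy (dx phi)) p = 0"
    and y_xx: "inn (dy phi) (dx (dx phi)) p = 0" and x_yy: "inn (dx phi) (dy (dy phi)) p = 0"
proof -
  note s = phi_smooth
  show "inn phi (dx (dx phi)) p = -1" using dx_ip_const[OF s(1,2) phi_x, where p = p] xx by simp
  show "inn phi (dy (dy phi)) p = -1" using dy_ip_const[OF s(1,3) phi_y, where p = p] yy by simp
  show "inn phi (dy (dx phi)) p = 0"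
    using dy_ip_const[OF s(1,2) phi_x, where p = p] xy[of p] ip_commute[of n "at_pt (dx phi) p" "at_pt (dy phi) p"] by simp
  show "inn (dx phi) (dx (dx phi)) p = 0"
    using dx_ip_const[OF s(2,2) xx, where p = p] ip_commute[of n "at_pt (dx phi) p" "at_pt (dx (dx phi)) p"] by simp
  show 1: "inn (dx phi) (dy (dx phi)) p = 0"
    using dy_ip_const[OF s(2,2) xx, where p = p] ip_commute[of n "at_pt (dx phi) p" "at_pt (dy (dx phi)) p"] by simp
  show 2: "inn (dy phi) (dy (dy phi)) p = 0"
    using dy_ip_const[OF s(3,3) yy, where p = p] ip_commute[of n "at_pt (dy phi) p" "at_pt (dy (dy phi)) p"] by simp
  show 3: "inn (dy phi) (dy (dx phi)) p = 0"
    using dx_ip_const[OF s(3,3) yy, where p = p] ip_commute[of n "at_pt (dy phi) p" "at_pt (dx (dy phi)) p"]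
    by (simp add: inn_dx_dy_phi)
  show "inn (dy phi) (dx (dx phi)) p = 0"
    using dx_ip_const[OF s(2,3) xy, where p = p] 1 ip_commute[of n "at_pt (dy phi) p" "at_pt (dx (dx phi)) p"]
    by (simp add: inn_dx_dy_phi)
  show "inn (dx phi) (dy (dy phi)) p = 0"
    using dy_ip_const[OF s(2,3) xy, where p = p] 3 ip_commute[of n "at_pt (dy phi) p" "at_pt (dy (dx phi)) p"]
    by simp
qed

text \<open>Two evaluations of the inner product of \<open>dy phi\<close> with the third derivative
  xxy agree. This is the Gauss equation for zero curvature; the ambient curvature 1 is hidden in the
  \<open>phi\<close>-components of the second derivatives.\<close>

lemma gauss: "inn (dx (dx phi)) (dy (dy phi)) p = inn (dy (dx phi)) (dy (dx phi)) p"
proof -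
  have c: "dx (dy (dx phi)) i = dy (dx (dx phi)) i" if "i \<le> n" for i
    using phi_smooth(2)[OF that] by (simp add: dx_def dy_def pdx_pdy_commute)
  have "inn (dy phi) (dx (dy (dx phi))) p = inn (dy phi) (dy (dx (dx phi))) p"
    by (simp add: ip_def at_pt_def c)
  moreover have "inn (dx (dy phi)) (dy (dx phi)) p + inn (dy phi) (dx (dy (dx phi))) p = 0"
    using dx_ip_const[OF phi_smooth(3,6) y_xy, where p = p] by simp
  moreover have "inn (dy (dy phi)) (dx (dx phi)) p + inn (dy phi) (dy (dx (dx phi))) p = 0"
    using dy_ip_const[OF phi_smooth(3,4) y_xx, where p = p] by simp
  ultimately show ?thesis
    using inn_dx_dy_phi[of "at_pt (dy (dx phi)) p" p]
      ip_commute[of n "at_pt (dx (dy phi)) p" "at_pt (dy (dx phi)) p"]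
      ip_commute[of n "at_pt (dx (dx phi)) p" "at_pt (dy (dy phi)) p"] by simp
qed

definition tau :: vmap where
  "tau i p = dx (dx phi) i p + dy (dy phi) i p + 2 * phi i p"

lemma tension_eq_tau: "tension n phi = tau"
proof (intro ext)
  fix i p
  have "inn (dx (dx phi)) phi p = -1" "inn (dy (dy phi)) phi p = -1"
    using phi_xx[of p] phi_yy[of p] by (metis ip_commute)+
  then show "tension n phi i p = tau i p"
    unfolding tension_def proj_def tau_def by (simp add: at_pt_apply)
qed

lemma inn_tau: "ip n u (at_pt tau p) =
    ip n u (at_pt (dx (dx phi)) p) + ip n u (at_pt (dy (dy phi)) p) + 2 * ip n u (at_pt phi p)"
  by (simp add: ip_def at_pt_def tau_def algebra_simps sum.distrib sum_distrib_left)

lemma tau_smooth: "smooth2 (tau i)" if "i \<le> n" for i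
proof -
  have "tau i = (\<lambda>p. 1 * (1 * dx (dx phi) i p + 1 * dy (dy phi) i p) + 2 * phi i p)"
    by (simp add: tau_def fun_eq_iff)
  then show ?thesis
    using smooth2_linear[OF smooth2_linear[OF phi_smooth(4,5)[OF that]] phi_smooth(1)[OF that]] by metis
qed

lemma tau_dx_smooth: "smooth2 (dx tau i)" "smooth2 (dy tau i)" if "i \<le> n" for i
  using tau_smooth[OF that] by (simp_all add: dx_def dy_def)

lemma phi_tau: "inn phi tau p = 0" and x_tau: "inn (dx phi) tau p = 0" and y_tau: "inn (dy phi) tau p = 0"
  using phi_phi phi_x phi_y
  by (simp_all add: inn_tau phi_xx phi_yy x_xx x_yy y_xx y_yy ip_commute[of n "at_pt (dx phi) p" "at_pt phi p"]
      ip_commute[of n "at_pt (dy phi) p" "at_pt phi p"])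

lemma tau_tau: "inn tau tau p = 4 * h\<^sup>2"
proof -
  have "h = sqrt (inn (\<lambda>i q. tau i q / 2) (\<lambda>i q. tau i q / 2) p)"
    using mc[of p] unfolding mean_curv_def tension_eq_tau by simp
  moreover have "inn (\<lambda>i q. tau i q / 2) (\<lambda>i q. tau i q / 2) p = inn tau tau p / 4"
    by (simp add: ip_def at_pt_def sum_divide_distrib)
  moreover have "inn tau tau p \<ge> 0" by (simp add: ip_def sum_nonneg)
  ultimately show ?thesis by simp
qed

lemma phi_dtau: "inn phi (dx tau) p = 0" "inn phi (dy tau) p = 0"
  using dx_ip_const[OF phi_smooth(1) tau_smooth phi_tau, where p = p]
    dy_ip_const[OF phi_smooth(1) tau_smooth phi_tau, where p = p] x_tau y_tau by auto

text \<open>Differentiating the orthogonality of \<open>phi\<close> and \<open>tau\<close> twice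
  moves both derivatives onto \<open>phi\<close>, and the Laplacian of \<open>phi\<close> is
  \<open>tau\<close> up to a multiple of \<open>phi\<close>.\<close>

lemma phi_ddtau: "inn phi (dx (dx tau)) p + inn phi (dy (dy tau)) p = 4 * h\<^sup>2"
proof -
  have "inn phi (dx (dx tau)) p = inn tau (dx (dx phi)) p"
    using dx_ip_const[OF phi_smooth(1) tau_dx_smooth(1) phi_dtau(1), where p = p]
      dx_ip_const[OF phi_smooth(2) tau_smooth x_tau, where p = p]
      ip_commute[of n "at_pt tau p" "at_pt (dx (dx phi)) p"] by simp
  moreover have "inn phi (dy (dy tau)) p = inn tau (dy (dy phi)) p"
    using dy_ip_const[OF phi_smooth(1) tau_dx_smooth(2) phi_dtau(2), where p = p]
      dy_ip_const[OF phi_smooth(3) tau_smooth y_tau, where p = p]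
      ip_commute[of n "at_pt tau p" "at_pt (dy (dy phi)) p"] by simp
  ultimately show ?thesis
    using tau_tau[of p] phi_tau[of p] ip_commute[of n "at_pt tau p" "at_pt phi p"]
    by (simp add: inn_tau)
qed

text \<open>All tangential terms of the bitension field vanish since \<open>tau\<close> is normal;
  the curvature terms leave 2 \<open>tau\<close>, and the projection removes the
  \<open>phi\<close>-component computed in \<open>phi_ddtau\<close>.\<close>

lemma laplace_tau:
  assumes "i \<le> n"
  shows "dx (dx tau) i p + dy (dy tau) i p = - 2 * tau i p + 4 * h\<^sup>2 * phi i p"
proof -
  have "bitension n phi i p = 0" using bih assms unfolding biharmonic_def by blast
  moreover have com: "inn tau (dx phi) p = inn (dx phi) tau p" "inn tau (dy phi) p = inn (dy phi) tau p"
    "inn (dx tau) phi p = inn phi (dx tau) p" "inn (dy tau) phi p = inn phi (dy tau) p"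
    "inn (dx (dx tau)) phi p = inn phi (dx (dx tau)) p" "inn (dy (dy tau)) phi p = inn phi (dy (dy tau)) p"
    by (rule ip_commute)+
  ultimately have "dx (dx tau) i p + dy (dy tau) i p
      - (inn phi (dx (dx tau)) p + inn phi (dy (dy tau)) p) * phi i p + 2 * tau i p = 0"
    unfolding bitension_def Let_def tension_eq_tau rough_term_def curv_term_def proj_def
    by (simp add: xx yy phi_dtau x_tau y_tau com at_pt_apply algebra_simps)
  then show ?thesis unfolding phi_ddtau by simp
qed

text \<open>If \<open>h\<close> were nonzero, \<open>tau / (2 h)\<close> would be the unit normal
  completing \<open>phi\<close>, \<open>dx phi\<close>, \<open>dy phi\<close> to an orthonormal
  basis of R^4, so Parseval expresses everything through three coefficients of the second
  fundamental form.\<close>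

lemma codimension_one_minimal:
  assumes "n = 3"
  shows "h = 0"
proof (rule ccontr)
  assume h: "h \<noteq> 0"
  obtain p :: "real \<times> real" where "p = 0" by blast
  define e where "e j =
    [at_pt phi p, at_pt (dx phi) p, at_pt (dy phi) p, \<lambda>i. tau i p / (2 * h)] ! j" for j
  have e3: "ip n u (e 3) = ip n u (at_pt tau p) / (2 * h)" for u
    by (simp add: e_def ip_def at_pt_def sum_divide_distrib)
  have e3': "ip n (e 3) u = ip n (at_pt tau p) u / (2 * h)" for u
    by (simp add: e_def ip_def at_pt_def sum_divide_distrib)
  have e: "e 0 = at_pt phi p" "e (Suc 0) = at_pt (dx phi) p" "e 2 = at_pt (dy phi) p"
    by (simp_all add: e_def)
  have on: "ip n (e j) (e k) = (if j = k then 1 else 0)" if "j \<le> n" "k \<le> n" for j k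
  proof -
    have *: "\<And>i. i \<le> n \<Longrightarrow> i = 0 \<or> i = Suc 0 \<or> i = 2 \<or> i = 3" using assms by auto
    have "ip n (e 3) (e 3) = 1"
      using h by (simp add: e3 e3' tau_tau power2_eq_square)
    moreover have "inn tau phi p = 0" "inn tau (dx phi) p = 0" "inn tau (dy phi) p = 0"
      using phi_tau[of p] x_tau[of p] y_tau[of p] by (metis ip_commute)+
    moreover have "inn (dx phi) phi p = 0" "inn (dy phi) phi p = 0" "inn (dy phi) (dx phi) p = 0"
      using phi_x[of p] phi_y[of p] xy[of p] by (metis ip_commute)+
    ultimately show ?thesis
      using *[OF that(1)] *[OF that(2)]
      by (auto simp: e e3 e3' phi_phi xx yy xy phi_x phi_y phi_tau x_tau y_tau)
  qed
  have pars: "ip n u v = ip n u (at_pt phi p) * ip n v (at_pt phi p)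
      + ip n u (at_pt (dx phi) p) * ip n v (at_pt (dx phi) p)
      + ip n u (at_pt (dy phi) p) * ip n v (at_pt (dy phi) p)
      + ip n u (at_pt tau p) * ip n v (at_pt tau p) / (4 * h\<^sup>2)" for u v
  proof -
    have "{..n} = {0, Suc 0, 2, 3}" using assms by auto
    then show ?thesis
      using orthonormal_parseval[OF on, of u v] h by (simp add: e e3 power2_eq_square)
  qed
  \<comment> \<open>the second fundamental form, paired with \<tau> = 2 h N instead of the unit normal N\<close>
  define b11 where "b11 = inn tau (dx (dx phi)) p"
  define b12 where "b12 = inn tau (dy (dx phi)) p"
  define b22 where "b22 = inn tau (dy (dy phi)) p"
  have trace: "b11 + b22 = 4 * h\<^sup>2"
    using tau_tau[of p] phi_tau[of p] ip_commute[of n "at_pt tau p" "at_pt phi p"]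
    by (simp add: inn_tau b11_def b22_def)
  have com: "inn (dx (dx phi)) v p = inn v (dx (dx phi)) p" "inn (dy (dy phi)) v p = inn v (dy (dy phi)) p"
    "inn (dy (dx phi)) v p = inn v (dy (dx phi)) p" for v by (rule ip_commute)+
  have "inn (dx (dx phi)) (dy (dy phi)) p = 1 + b11 * b22 / (4 * h\<^sup>2)"
    by (subst pars) (simp add: com phi_xx phi_yy x_xx x_yy y_xx y_yy b11_def b22_def)
  moreover have "inn (dy (dx phi)) (dy (dx phi)) p = b12\<^sup>2 / (4 * h\<^sup>2)"
    by (subst pars) (simp add: com phi_xy x_xy y_xy b12_def power2_eq_square)
  ultimately have det: "4 * h\<^sup>2 + b11 * b22 = b12\<^sup>2"
    using gauss[of p] h by (simp add: field_simps)
  have dtau: "inn (dx tau) tau p = 0" "inn (dy tau) tau p = 0" for p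
    using dx_ip_const[OF tau_smooth tau_smooth tau_tau, where p = p]
      dy_ip_const[OF tau_smooth tau_smooth tau_tau, where p = p]
      ip_commute[of n "at_pt tau p" "at_pt (dx tau) p"] ip_commute[of n "at_pt tau p" "at_pt (dy tau) p"]
    by simp_all
  have "inn (dx (dx tau)) tau p + inn (dx tau) (dx tau) p = 0"
    "inn (dy (dy tau)) tau p + inn (dy tau) (dy tau) p = 0"
    using dx_ip_const[OF tau_dx_smooth(1) tau_smooth dtau(1), where p = p]
      dy_ip_const[OF tau_dx_smooth(2) tau_smooth dtau(2), where p = p] by simp_all
  moreover have "inn (dx (dx tau)) tau p + inn (dy (dy tau)) tau p = - 2 * inn tau tau p + 4 * h\<^sup>2 * inn phi tau p"
  proof -
    have "inn (dx (dx tau)) tau p + inn (dy (dy tau)) tau p =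
        (\<Sum>i\<le>n. (dx (dx tau) i p + dy (dy tau) i p) * tau i p)"
      by (simp add: ip_def at_pt_def algebra_simps sum.distrib)
    also have "\<dots> = (\<Sum>i\<le>n. (- 2 * tau i p + 4 * h\<^sup>2 * phi i p) * tau i p)"
      by (intro sum.cong) (auto simp: laplace_tau)
    finally show ?thesis
      by (simp add: ip_def at_pt_def algebra_simps sum.distrib sum_subtractf sum_negf sum_distrib_left)
  qed
  \<comment> \<open>Half the Laplacian of the constant squared length of \<open>tau\<close> is 0, so
    the squared gradient of \<open>tau\<close> is minus the inner product of its Laplacian with
    \<open>tau\<close>.\<close>
  ultimately have grad: "inn (dx tau) (dx tau) p + inn (dy tau) (dy tau) p = 8 * h\<^sup>2"
    by (simp add: tau_tau phi_tau)
  \<comment> \<open>The Weingarten equations: together with \<open>dtau\<close> they show that the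
    derivatives of \<open>tau\<close> are purely tangential.\<close>
  have t: "inn (dx tau) phi p = 0" "inn (dy tau) phi p = 0"
    "inn (dx tau) (dx phi) p = - b11" "inn (dx tau) (dy phi) p = - b12"
    "inn (dy tau) (dx phi) p = - b12" "inn (dy tau) (dy phi) p = - b22"
    using phi_dtau[of p]
      dx_ip_const[OF tau_smooth phi_smooth(2) x_tau[unfolded ip_commute[of n _ "at_pt tau _"]], where p = p]
      dy_ip_const[OF tau_smooth phi_smooth(2) x_tau[unfolded ip_commute[of n _ "at_pt tau _"]], where p = p]
      dx_ip_const[OF tau_smooth phi_smooth(3) y_tau[unfolded ip_commute[of n _ "at_pt tau _"]], where p = p]
      dy_ip_const[OF tau_smooth phi_smooth(3) y_tau[unfolded ip_commute[of n _ "at_pt tau _"]], where p = p]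
    by (simp_all add: b11_def b12_def b22_def inn_dx_dy_phi ip_commute[of n "at_pt phi p"])
  have "inn (dx tau) (dx tau) p = b11\<^sup>2 + b12\<^sup>2" "inn (dy tau) (dy tau) p = b12\<^sup>2 + b22\<^sup>2"
    \<comment> \<open>With these values \<open>grad\<close> reads b11^2 + 2 b12^2 + b22^2 = 8 h^2,
      that is |B|^2 = 2; adding twice \<open>det\<close> leaves the square of the trace equal to
      0.\<close>
    by (subst pars, simp add: t dtau power2_eq_square)+
  moreover have "(b11 + b22)\<^sup>2 = b11\<^sup>2 + b22\<^sup>2 + 2 * (b11 * b22)" by (simp add: power2_sum)
  ultimately have "(b11 + b22)\<^sup>2 = 0" using grad det by linarith
  with trace h show False by simp
qed

section \<open>Spectral decomposition of the immersion\<close>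

lemma phi_periodic:
  assumes "i \<le> n"
  shows "phi i (x + 2 * pi * a, y) = phi i (x, y)" "phi i (x, y + 2 * pi * a) = phi i (x, y)"
  using imm assms unfolding torus_full_isometric_immersion_def by blast+

lemma tau_periodic:
  assumes i: "i \<le> n"
  shows "tau i (x + 2 * pi * a, y) = tau i (x, y)" "tau i (x, y + 2 * pi * a) = tau i (x, y)"
proof -
  note s = phi_smooth[OF i] and per = phi_periodic[OF i]
  have x: "dx phi i (x + 2 * pi * a, y) = dx phi i (x, y)" for x y
    unfolding dx_def by (rule pdx_periodic[OF s(1) per(1)])
  have y: "dy phi i (x, y + 2 * pi * a) = dy phi i (x, y)" for x y
    unfolding dy_def by (rule pdy_periodic[OF s(1) per(2)])
  have "dx (dx phi) i (x + 2 * pi * a, y) = dx (dx phi) i (x, y)"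
    unfolding dx_def[of "dx phi"] by (rule pdx_periodic[OF s(2) x])
  moreover have "dy (dy phi) i (x, y + 2 * pi * a) = dy (dy phi) i (x, y)"
    unfolding dy_def[of "dy phi"] by (rule pdy_periodic[OF s(3) y])
  moreover have "dy (dy phi) i (x + 2 * pi * a, y) = dy (dy phi) i (x, y)"
    "dx (dx phi) i (x, y + 2 * pi * a) = dx (dx phi) i (x, y)"
    by (simp_all add: dx_def dy_def pdx_def pdy_def per)
  ultimately show "tau i (x + 2 * pi * a, y) = tau i (x, y)" "tau i (x, y + 2 * pi * a) = tau i (x, y)"
    by (simp_all add: tau_def per)
qed

text \<open>The sign \<open>s\<close> selects the eigenspace, and the components for 1 and -1 add up
  to \<open>phi\<close>. The factor 1 / (4 h) scales \<open>tau\<close>, of length 2 h, to the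
  length 1/2 of the other summand.\<close>

definition eig :: "real \<Rightarrow> vmap" where
  "eig s i p = 1 / 2 * phi i p + s / (4 * h) * tau i p"

lemma eig_smooth: "i \<le> n \<Longrightarrow> smooth2 (eig s i)"
  unfolding eig_def[abs_def] by (intro smooth2_linear phi_smooth(1) tau_smooth)

lemma eig_laplace:
  assumes i: "i \<le> n" and s: "s * s = 1" and h: "h \<noteq> 0"
  shows "pdx (pdx (eig s i)) p + pdy (pdy (eig s i)) p = - (2 - 2 * s * h) * eig s i p"
proof -
  note sm = phi_smooth(1)[OF i] tau_smooth[OF i]
  have "pdx (pdx (eig s i)) p = 1 / 2 * dx (dx phi) i p + s / (4 * h) * dx (dx tau) i p"
    "pdy (pdy (eig s i)) p = 1 / 2 * dy (dy phi) i p + s / (4 * h) * dy (dy tau) i p"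
    unfolding eig_def[abs_def] dx_def dy_def
    by (simp_all only: pdx_linear[OF sm] pdy_linear[OF sm] pdx_linear[OF smooth2_pdx smooth2_pdx, OF sm]
        pdy_linear[OF smooth2_pdy smooth2_pdy, OF sm])
  then have "pdx (pdx (eig s i)) p + pdy (pdy (eig s i)) p =
      1 / 2 * (dx (dx phi) i p + dy (dy phi) i p) + s / (4 * h) * (dx (dx tau) i p + dy (dy tau) i p)"
    by (simp add: distrib_left)
  also have "\<dots> = 1 / 2 * (tau i p - 2 * phi i p) + s / (4 * h) * (- 2 * tau i p + 4 * h\<^sup>2 * phi i p)"
    unfolding laplace_tau[OF i] by (simp add: tau_def)
  also have "\<dots> = (s * h - 1) * phi i p + (1 / 2 - s / (2 * h)) * tau i p"
    using h by (simp add: field_simps power2_eq_square)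
  \<comment> \<open>Inserting s^2 = 1 here makes the remaining factorisation an identity valid for
    every \<open>s\<close>.\<close>
  also have "1 / 2 - s / (2 * h) = (s * s) / 2 - s / (2 * h)" using s by simp
  also have "(s * h - 1) * phi i p + ((s * s) / 2 - s / (2 * h)) * tau i p = - (2 - 2 * s * h) * eig s i p"
    unfolding eig_def using h by (simp add: field_simps)
  finally show ?thesis .
qed

definition freqs :: "real \<Rightarrow> (int \<times> int) set" where
  "freqs s = {v. of_int ((fst v)\<^sup>2 + (snd v)\<^sup>2) = (2 - 2 * s * h) * a\<^sup>2}"

lemma eig_coeff:
  assumes "i \<le> n" "s * s = 1" "h \<noteq> 0" "v \<notin> freqs s"
  shows "integral (fund_square a) (\<lambda>p. eig s i p * cos (phase a v p + c)) = 0"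
proof (rule eigenfunction_fourier_coeff[OF a eig_smooth[OF assms(1)] _ _ eig_laplace[OF assms(1-3)]])
  show "eig s i (x + 2 * pi * a, y) = eig s i (x, y)" "eig s i (x, y + 2 * pi * a) = eig s i (x, y)" for x y
    by (simp_all only: eig_def tau_periodic[OF assms(1)] phi_periodic[OF assms(1)])
qed (use assms(4) in \<open>simp add: freqs_def\<close>)

text \<open>Without frequencies \<open>eig s\<close> would vanish by Fourier uniqueness, yet its
  inner product with \<open>phi\<close> is 1/2.\<close>

lemma freqs_nonempty:
  assumes s: "s * s = 1" and h: "h \<noteq> 0"
  shows "freqs s \<noteq> {}"
proof
  assume e: "freqs s = {}"
  have "eig s i p = 0" if i: "i \<le> n" for i p
  proof (rule fourier_uniqueness[OF a smooth2_continuous[OF eig_smooth[OF i]]])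
    show "eig s i (x + 2 * pi * a, y) = eig s i (x, y)" "eig s i (x, y + 2 * pi * a) = eig s i (x, y)" for x y
      by (simp_all only: eig_def tau_periodic[OF i] phi_periodic[OF i])
  qed (rule eig_coeff[OF i s h], simp add: e)
  then have "ip n (at_pt phi 0) (at_pt (eig s) 0) = 0" by (simp add: ip_def at_pt_def)
  moreover have "ip n (at_pt phi 0) (at_pt (eig s) 0) =
      1 / 2 * inn phi phi 0 + s / (4 * h) * inn phi tau 0"
    by (simp add: ip_def at_pt_def eig_def algebra_simps sum.distrib sum_distrib_left sum_divide_distrib)
  ultimately show False by (simp add: phi_phi phi_tau)
qed

text \<open>One lattice point turns the real radius into an integer; this is how \<open>h\<close>
  and \<open>a\<close>, a priori arbitrary reals, become arithmetic.\<close>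

lemma freqs_eq:
  assumes "v \<in> freqs s"
  shows "freqs s = {w. (fst w)\<^sup>2 + (snd w)\<^sup>2 = (fst v)\<^sup>2 + (snd v)\<^sup>2}"
proof -
  have "(2 - 2 * s * h) * a\<^sup>2 = of_int ((fst v)\<^sup>2 + (snd v)\<^sup>2)" using assms by (simp add: freqs_def)
  then show ?thesis unfolding freqs_def by (simp only: of_int_eq_iff)
qed

lemma finite_freqs: "finite (freqs s)"
proof (cases "freqs s = {}")
  case False
  then obtain v where v: "v \<in> freqs s" by blast
  show ?thesis unfolding freqs_eq[OF v] by (rule finite_norm_level)
qed simp

text \<open>With fewer frequencies than coordinates, some nonzero combination of the coordinates is
  orthogonal to all available characters. It is orthogonal to the other characters anyway, so it
  vanishes, against fullness.\<close>

lemma dimension_bound: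
  assumes h: "h \<noteq> 0"
  shows "n + 1 \<le> card (freqs 1 \<union> freqs (-1))"
proof (rule ccontr)
  define E where "E = freqs 1 \<union> freqs (-1)"
  define J where "J f g = integral (fund_square a) (\<lambda>p. f p * g p)" for f g :: "real \<times> real \<Rightarrow> real"
  assume "\<not> n + 1 \<le> card (freqs 1 \<union> freqs (-1))"
  then have "card E < card {..n}" "finite E" by (simp_all add: E_def finite_freqs)
  with underdetermined_system[of E "{..n}" "\<lambda>i v. J (phi i) (\<lambda>p. cas (phase a v p))"]
  obtain c where c: "\<exists>i\<in>{..n}. c i \<noteq> 0"
    "\<And>v. v \<in> E \<Longrightarrow> (\<Sum>i\<le>n. c i * J (phi i) (\<lambda>p. cas (phase a v p))) = 0" by blast
  define \<Phi> where "\<Phi> p = (\<Sum>i\<le>n. c i * phi i p)" for p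
  have cont: "continuous_on S (phi i)" if "i \<le> n" for S i
    using smooth2_continuous[OF phi_smooth(1)[OF that]] by (rule continuous_on_subset) simp
  have contPhi: "continuous_on S \<Phi>" for S
    unfolding \<Phi>_def by (intro continuous_intros cont) simp
  have JPhi: "J \<Phi> g = (\<Sum>i\<le>n. c i * J (phi i) g)" if "\<And>S. continuous_on S g" for g
    unfolding J_def \<Phi>_def sum_distrib_right mult.assoc
    by (subst integral_sum)
      (auto intro!: integrable_continuous continuous_on_mult continuous_on_const cont that)
  have neg: "v \<in> E \<Longrightarrow> - v \<in> E" for v by (auto simp: E_def freqs_def)
  have orth: "J \<Phi> (\<lambda>p. cos (phase a v p + d)) = 0" for v d
  proof (cases "v \<in> E")
    case True
    \<comment> \<open>The solution of u + w = cos d, u - w = - sin d, which writes the shifted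
      cosine through \<open>cas\<close> at \<open>v\<close> and \<open>- v\<close>; the latter
      frequency is in \<open>E\<close> by symmetry.\<close>
    let ?u = "(cos d - sin d) / 2" and ?w = "(cos d + sin d) / 2"
    have "\<Phi> p * cos (phase a v p + d) =
        ?u * (\<Phi> p * cas (phase a v p)) + ?w * (\<Phi> p * cas (phase a (- v) p))" for p
    proof -
      have "phase a (- v) p = - phase a v p"
        by (rule phase_uminus)
      then show ?thesis by (simp add: cas_def cos_add field_simps)
    qed
    then have "J \<Phi> (\<lambda>p. cos (phase a v p + d)) =
        integral (fund_square a) (\<lambda>p. ?u * (\<Phi> p * cas (phase a v p)) + ?w * (\<Phi> p * cas (phase a (- v) p)))"
      by (simp only: J_def)
    also have "\<dots> = ?u * J \<Phi> (\<lambda>p. cas (phase a v p)) + ?w * J \<Phi> (\<lambda>p. cas (phase a (- v) p))"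
      unfolding J_def integral_mult_right[symmetric]
      by (rule integral_add) (intro integrable_continuous continuous_intros contPhi)+
    also have "\<dots> = 0"
      using c(2)[OF True] c(2)[OF neg[OF True]] by (subst (1 2) JPhi) (auto intro!: continuous_intros)
    finally show ?thesis .
  next
    case False
    have "J (phi i) (\<lambda>p. cos (phase a v p + d)) = 0" if i: "i \<le> n" for i
    proof -
      have eq: "phi i p = eig 1 i p + eig (-1) i p" for p by (simp add: eig_def)
      have ce: "continuous_on S (eig s i)" for S s
        using smooth2_continuous[OF eig_smooth[OF i]] by (rule continuous_on_subset) simp
      have "J (phi i) (\<lambda>p. cos (phase a v p + d)) =
        integral (fund_square a) (\<lambda>p. eig 1 i p * cos (phase a v p + d))
        + integral (fund_square a) (\<lambda>p. eig (-1) i p * cos (phase a v p + d))"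
        unfolding J_def eq distrib_right
        by (rule integral_add) (intro integrable_continuous continuous_intros ce)+
      then show ?thesis
        using False eig_coeff[OF i _ h, of _ v d] by (simp add: E_def)
    qed
    then show ?thesis by (subst JPhi) (auto intro!: continuous_intros)
  qed
  have "\<Phi> p = 0" for p
  proof (rule fourier_uniqueness[OF a contPhi])
    show "\<Phi> (x + 2 * pi * a, y) = \<Phi> (x, y)" "\<Phi> (x, y + 2 * pi * a) = \<Phi> (x, y)" for x y
      unfolding \<Phi>_def by (intro sum.cong refl; simp only: phi_periodic atMost_iff)+
  qed (use orth in \<open>simp only: J_def\<close>)
  then have "ip n c (at_pt phi p) = 0" for p by (simp only: \<Phi>_def ip_def at_pt_def)
  then have "\<forall>i\<le>n. c i = 0"
    using imm unfolding torus_full_isometric_immersion_def by blast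
  with c(1) show False by simp
qed

text \<open>One lattice point on each circle supplies the integers. The squared radii (2 - 2 h) a^2
  and (2 + 2 h) a^2 have sum 4 a^2 and difference 4 h a^2, which recovers \<open>h\<close>.\<close>

lemma cmc_biharmonic_necessary:
  assumes h: "0 < h" "h < 1"
  shows "\<exists>p1 q1 p2 q2 :: nat.
       0 < p1\<^sup>2 + q1\<^sup>2 \<and> p1\<^sup>2 + q1\<^sup>2 < p2\<^sup>2 + q2\<^sup>2 \<and>
       4 * a\<^sup>2 = real (p1\<^sup>2 + q1\<^sup>2 + p2\<^sup>2 + q2\<^sup>2) \<and>
       h = (real (p2\<^sup>2 + q2\<^sup>2) - real (p1\<^sup>2 + q1\<^sup>2)) / real (p1\<^sup>2 + q1\<^sup>2 + p2\<^sup>2 + q2\<^sup>2) \<and>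
       n + 1 \<le> r2 (p1\<^sup>2 + q1\<^sup>2) + r2 (p2\<^sup>2 + q2\<^sup>2)"
proof -
  have h0: "h \<noteq> 0" using h by simp
  obtain v w where v: "v \<in> freqs 1" and w: "w \<in> freqs (-1)"
    using freqs_nonempty[OF _ h0, of 1] freqs_nonempty[OF _ h0, of "-1"] by auto
  define p1 q1 p2 q2 where "p1 = nat \<bar>fst v\<bar>" and "q1 = nat \<bar>snd v\<bar>"
    and "p2 = nat \<bar>fst w\<bar>" and "q2 = nat \<bar>snd w\<bar>"
  have iv: "int (p1\<^sup>2 + q1\<^sup>2) = (fst v)\<^sup>2 + (snd v)\<^sup>2" and iw: "int (p2\<^sup>2 + q2\<^sup>2) = (fst w)\<^sup>2 + (snd w)\<^sup>2"
    by (simp_all add: p1_def q1_def p2_def q2_def)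
  have m1: "real (p1\<^sup>2 + q1\<^sup>2) = (2 - 2 * h) * a\<^sup>2"
    using v unfolding freqs_def mem_Collect_eq iv[symmetric] of_int_of_nat_eq by simp
  have m2: "real (p2\<^sup>2 + q2\<^sup>2) = (2 + 2 * h) * a\<^sup>2"
    using w unfolding freqs_def mem_Collect_eq iw[symmetric] of_int_of_nat_eq by simp
  have "card (freqs 1 \<union> freqs (-1)) \<le> card (freqs 1) + card (freqs (-1))" by (rule card_Un_le)
  also have "\<dots> = r2 (p1\<^sup>2 + q1\<^sup>2) + r2 (p2\<^sup>2 + q2\<^sup>2)"
    unfolding r2_def iv iw freqs_eq[OF v] freqs_eq[OF w] ..
  finally have card: "n + 1 \<le> r2 (p1\<^sup>2 + q1\<^sup>2) + r2 (p2\<^sup>2 + q2\<^sup>2)"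
    using dimension_bound[OF h0] by linarith
  have a2: "a\<^sup>2 > 0" using a by simp
  have "0 < real (p1\<^sup>2 + q1\<^sup>2)" unfolding m1 using h a2 by simp
  moreover have "real (p1\<^sup>2 + q1\<^sup>2) < real (p2\<^sup>2 + q2\<^sup>2)" unfolding m1 m2 using h a2 by simp
  moreover have sum: "real (p1\<^sup>2 + q1\<^sup>2 + p2\<^sup>2 + q2\<^sup>2) = 4 * a\<^sup>2"
    using m1 m2 by (simp add: algebra_simps)
  moreover have "h = (real (p2\<^sup>2 + q2\<^sup>2) - real (p1\<^sup>2 + q1\<^sup>2)) / real (p1\<^sup>2 + q1\<^sup>2 + p2\<^sup>2 + q2\<^sup>2)"
    unfolding sum m1 m2 using a2 by (simp add: field_simps)
  ultimately show ?thesis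
    using card unfolding of_nat_0_less_iff of_nat_less_iff by (intro exI conjI) (assumption | simp)+
qed

end

section \<open>Immersions from weighted frequencies\<close>

text \<open>An even positive measure on lattice points of one circle, with mass \<open>M\<close> and
  second moment matrix diag(\<open>X\<close>, \<open>Y\<close>). The moments are parameters because
  single pieces may be anisotropic and only the total must be scalar; \<open>F\<close> may be
  empty.\<close>

definition weighted_freqs ::
  "(int \<times> int) set \<Rightarrow> (int \<times> int \<Rightarrow> real) \<Rightarrow> nat \<Rightarrow> real \<Rightarrow> real \<Rightarrow> real \<Rightarrow> bool" where
  "weighted_freqs F B m M X Y \<longleftrightarrow> finite F \<and>
     (\<forall>v\<in>F. 0 < B v \<and> - v \<in> F \<and> B (- v) = B v \<and> (fst v)\<^sup>2 + (snd v)\<^sup>2 = int m) \<and>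
     (\<Sum>v\<in>F. B v) = M \<and> (\<Sum>v\<in>F. B v * (of_int (fst v))\<^sup>2) = X \<and>
     (\<Sum>v\<in>F. B v * (of_int (snd v))\<^sup>2) = Y \<and> (\<Sum>v\<in>F. B v * of_int (fst v * snd v)) = 0"

section \<open>Sums over symmetric frequency sets and the explicit immersion\<close>

lemma sum_uminus_reindex:
  assumes "\<And>v. v \<in> F \<Longrightarrow> - v \<in> (F :: 'a::group_add set)"
  shows "(\<Sum>v\<in>F. g (- v)) = (\<Sum>v\<in>F. g v)"
  by (rule sum.reindex_bij_witness[of _ uminus uminus]) (auto simp: assms)

text \<open>Pairing \<open>v\<close> with \<open>- v\<close> replaces the square by the average of
  two squares with sum 2, so the dependence on the point disappears.\<close>

lemma sum_even_cas_sq: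
  assumes "\<And>v. v \<in> F \<Longrightarrow> - v \<in> F" "\<And>v. v \<in> F \<Longrightarrow> g (- v) = g v"
  shows "(\<Sum>v\<in>F. g v * (cas (phase a v p))\<^sup>2) = sum g F"
    and "(\<Sum>v\<in>F. g v * (cas (- phase a v p))\<^sup>2) = sum g F"
proof -
  have eq: "(\<Sum>v\<in>F. g v * (cas (phase a v p))\<^sup>2) = (\<Sum>v\<in>F. g v * (cas (- phase a v p))\<^sup>2)"
    using sum_uminus_reindex[of F "\<lambda>v. g v * (cas (phase a v p))\<^sup>2", OF assms(1)]
    by (simp add: assms(2) phase_uminus)
  have "(cas t)\<^sup>2 + (cas (- t))\<^sup>2 = 2" for t
  proof -
    have "(cas t)\<^sup>2 + (cas (- t))\<^sup>2 = 2 * ((sin t)\<^sup>2 + (cos t)\<^sup>2)"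
      unfolding cas_def by (simp add: power2_sum power2_diff)
    then show ?thesis by simp
  qed
  then have "(\<Sum>v\<in>F. g v * ((cas (phase a v p))\<^sup>2 + (cas (- phase a v p))\<^sup>2)) = 2 * sum g F"
    by (simp add: sum_distrib_right mult.commute)
  then show "(\<Sum>v\<in>F. g v * (cas (phase a v p))\<^sup>2) = sum g F"
    "(\<Sum>v\<in>F. g v * (cas (- phase a v p))\<^sup>2) = sum g F"
    using eq by (simp_all add: distrib_left sum.distrib)
qed

lemma sum_odd_cas_cas:
  assumes "\<And>v. v \<in> F \<Longrightarrow> - v \<in> F" "\<And>v. v \<in> F \<Longrightarrow> g (- v) = - g v"
  shows "(\<Sum>v\<in>F. g v * (cas (phase a v p) * cas (- phase a v p))) = 0"
proof -
  have "(\<Sum>v\<in>F. g v * (cas (phase a v p) * cas (- phase a v p))) =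
      - (\<Sum>v\<in>F. g v * (cas (phase a v p) * cas (- phase a v p)))"
    using sum_uminus_reindex[of F "\<lambda>v. g v * (cas (phase a v p) * cas (- phase a v p))", OF assms(1)]
    by (simp add: assms(2) phase_uminus mult.commute[of "cas (- phase a _ p)"] sum_negf)
  then show ?thesis by simp
qed

lemma cas_has_derivative:
  "(cas has_real_derivative cas (- t)) (at t)"
  unfolding cas_def[abs_def] by (auto intro!: derivative_eq_intros)

lemma cas_has_derivative_chain [derivative_intros]:
  assumes "(g has_real_derivative g') (at x)"
  shows "((\<lambda>x. cas (g x)) has_real_derivative cas (- g x) * g') (at x)"
  using DERIV_chain2[OF cas_has_derivative assms] .

lemma pdx_cas_phase:
  "pdx (\<lambda>p. c * cas (phase a v p)) = (\<lambda>p. c * (of_int (fst v) / a) * cas (- phase a v p))"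
  "pdx (\<lambda>p. c * cas (- phase a v p)) = (\<lambda>p. - c * (of_int (fst v) / a) * cas (phase a v p))"
  by (rule pdx_eqI; (rule derivative_eq_intros phase_has_derivative refl)+; simp)+

lemma pdy_cas_phase:
  "pdy (\<lambda>p. c * cas (phase a v p)) = (\<lambda>p. c * (of_int (snd v) / a) * cas (- phase a v p))"
  "pdy (\<lambda>p. c * cas (- phase a v p)) = (\<lambda>p. - c * (of_int (snd v) / a) * cas (phase a v p))"
  by (rule pdy_eqI; (rule derivative_eq_intros phase_has_derivative refl)+; simp)+

lemma smooth2_cas_phase: "smooth2 (\<lambda>p. c * cas (phase a v p))"
proof -
  let ?k = "of_int (fst v) / a :: real" and ?l = "of_int (snd v) / a :: real"
  \<comment> \<open>Each derivative shifts the argument of \<open>cas\<close> by a quarter period,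
    since \<open>cas (t + pi / 2) = cas (- t)\<close>; this gives all partials in closed
    form.\<close>
  define D where "D i j p = c * ?k ^ i * ?l ^ j * cas (phase a v p + real (i + j) * (pi / 2))" for i j p
  have quarter: "cas (t + pi / 2) = cas (- t)" for t
    by (simp add: cas_def cos_add sin_add)
  have shift: "cas (t + real (Suc m) * (pi / 2)) = cas (- (t + real m * (pi / 2)))" for t m
  proof -
    have "t + real (Suc m) * (pi / 2) = (t + real m * (pi / 2)) + pi / 2" by (simp add: algebra_simps)
    then show ?thesis by (simp only: quarter)
  qed
  have ph: "(phase a v has_derivative (\<lambda>h. ?k * fst h + ?l * snd h)) (at p)" for p
    unfolding phase_def[abs_def] divide_inverse
    by (auto intro!: derivative_eq_intros simp: algebra_simps)
  have "(D i j has_derivative (\<lambda>h. D (Suc i) j p * fst h + D i (Suc j) p * snd h)) (at p)" for i j p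
  proof -
    have "((\<lambda>p. phase a v p + real (i + j) * (pi / 2)) has_derivative (\<lambda>h. ?k * fst h + ?l * snd h)) (at p)"
      using has_derivative_add[OF ph has_derivative_const] by simp
    from has_derivative_compose[OF this cas_has_derivative[unfolded has_field_derivative_def]]
    have "((\<lambda>p. cas (phase a v p + real (i + j) * (pi / 2))) has_derivative
      (\<lambda>h. cas (- (phase a v p + real (i + j) * (pi / 2))) * (?k * fst h + ?l * snd h))) (at p)" .
    from has_derivative_mult_right[OF this, of "c * ?k ^ i * ?l ^ j"]
    show ?thesis
      unfolding D_def add_Suc add_Suc_right shift by (simp add: algebra_simps)
  qed
  moreover have "D 0 0 = (\<lambda>p. c * cas (phase a v p))" by (simp add: D_def fun_eq_iff)
  ultimately show ?thesis unfolding smooth2_def by blast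
qed

text \<open>Amplitudes are square roots of the weights, so inner products become moments of the
  weights: the total mass 1 puts the image on the unit sphere, and the second moments are the metric
  up to the factor a^2.\<close>

lemma cmc_biharmonic_of_weighted_freqs:
  assumes a: "a > 0" and F1: "weighted_freqs F1 B1 m1 (1/2) X1 Y1" and F2: "weighted_freqs F2 B2 m2 (1/2) X2 Y2"
    and m: "m1 < m2" and a2: "4 * a\<^sup>2 = real (m1 + m2)"
    and X: "X1 + X2 = a\<^sup>2" and Y: "Y1 + Y2 = a\<^sup>2" and n: "card F1 + card F2 = n + 1"
  shows "CMC_torus_biharmonic a n ((real m2 - real m1) / real (m1 + m2))"
proof -
  define F where "F = F1 \<union> F2"
  define B where "B v = (if v \<in> F1 then B1 v else B2 v)" for v
  \<comment> \<open>The sign of the eigenspace: the tension field multiplies the coordinate of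
    frequency \<open>v\<close> by \<open>2 * h * \<epsilon> v\<close>.\<close>
  define \<epsilon> :: "int \<times> int \<Rightarrow> real" where "\<epsilon> v = (if v \<in> F1 then 1 else - 1)" for v
  define h where "h = (real m2 - real m1) / real (m1 + m2)"
  note W1 = F1[unfolded weighted_freqs_def] and W2 = F2[unfolded weighted_freqs_def]
  have disj: "F1 \<inter> F2 = {}" using W1 W2 m by fastforce
  have fin: "finite F1" "finite F2" "finite F" using W1 W2 by (auto simp: F_def)
  have cF: "card F = n + 1" using n disj fin by (simp add: F_def card_Un_disjoint)
  have split: "sum g F = sum g F1 + sum g F2" for g :: "_ \<Rightarrow> real"
    unfolding F_def by (rule sum.union_disjoint[OF fin(1,2) disj])
  have F2': "v \<notin> F1" if "v \<in> F2" for v using that disj by blast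
  have neg: "- v \<in> F" if "v \<in> F" for v using that W1 W2 by (auto simp: F_def)
  have neg1: "- v \<in> F1 \<longleftrightarrow> v \<in> F1" for v using W1 by (metis minus_minus)
  have Bneg: "B (- v) = B v" if "v \<in> F" for v using that W1 W2 by (auto simp: F_def B_def neg1)
  have eneg: "\<epsilon> (- v) = \<epsilon> v" for v by (simp add: \<epsilon>_def neg1)
  have Bpos: "B v > 0" if "v \<in> F" for v using that W1 W2 by (auto simp: F_def B_def)
  have BF: "sum B F = 1" "sum (\<lambda>v. B v * \<epsilon> v) F = 0"
    using W1 W2 by (simp_all add: split B_def \<epsilon>_def F2' sum_negf cong: sum.cong)
  have BX: "(\<Sum>v\<in>F. B v * (of_int (fst v))\<^sup>2) = a\<^sup>2" and BY: "(\<Sum>v\<in>F. B v * (of_int (snd v))\<^sup>2) = a\<^sup>2"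
    and BXY: "(\<Sum>v\<in>F. B v * of_int (fst v * snd v)) = 0"
    using W1 W2 X Y by (simp_all add: split B_def F2' cong: sum.cong)
  have m0: "real (m1 + m2) > 0" "a\<^sup>2 > 0" using m a by auto
  have h: "0 < h" using m m0 by (simp add: h_def)
  have ha: "h * (4 * a\<^sup>2) = real m2 - real m1" unfolding a2 h_def using m0 by simp
  have norm: "((of_int (fst v))\<^sup>2 + (of_int (snd v))\<^sup>2) / a\<^sup>2 = 2 - 2 * \<epsilon> v * h" if "v \<in> F" for v
  proof -
    have "(of_int (fst v))\<^sup>2 + (of_int (snd v))\<^sup>2 = (if v \<in> F1 then real m1 else real m2)"
    proof -
      have "(fst v)\<^sup>2 + (snd v)\<^sup>2 = int (if v \<in> F1 then m1 else m2)"
        using that W1 W2 by (auto simp: F_def)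
      then have "real_of_int ((fst v)\<^sup>2 + (snd v)\<^sup>2) = real (if v \<in> F1 then m1 else m2)" by simp
      then show ?thesis by simp
    qed
    also have "\<dots> = (2 - 2 * \<epsilon> v * h) * a\<^sup>2"
    proof -
      have eq: "(2 - 2 * s * h) * a\<^sup>2 = 2 * a\<^sup>2 - s * ((real m2 - real m1) / 2)" for s
        unfolding ha[symmetric] by (simp add: algebra_simps)
      have "2 * a\<^sup>2 = (real m1 + real m2) / 2" using a2 by simp
      then show ?thesis unfolding eq by (simp add: \<epsilon>_def field_simps)
    qed
    finally show ?thesis using m0 by simp
  qed
  obtain e where e: "bij_betw e {..n} F"
    using ex_bij_betw_nat_finite[OF fin(3)] cF by (auto simp: atLeast0LessThan lessThan_Suc_atMost)
  have eF: "e i \<in> F" if "i \<le> n" for i using e that by (auto simp: bij_betw_def)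
  have re: "(\<Sum>i\<le>n. g (e i)) = sum g F" for g :: "_ \<Rightarrow> real" by (rule sum.reindex_bij_betw[OF e])
  define k l where "k v = of_int (fst v) / a" and "l v = of_int (snd v) / a" for v :: "int \<times> int"
  have kn: "k (- v) = - k v" "l (- v) = - l v" for v by (simp_all add: k_def l_def)
  define A where "A v = sqrt (B v)" for v
  have AA: "A v * A v = B v" if "v \<in> F" for v using Bpos[OF that] by (simp add: A_def)
  define phi :: vmap where "phi i = (\<lambda>p. A (e i) * cas (phase a (e i) p))" for i
  define tau :: vmap where "tau i = (\<lambda>p. 2 * h * \<epsilon> (e i) * A (e i) * cas (phase a (e i) p))" for i
  have d1: "dx phi i = (\<lambda>p. A (e i) * k (e i) * cas (- phase a (e i) p))"
    "dy phi i = (\<lambda>p. A (e i) * l (e i) * cas (- phase a (e i) p))" for i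
    unfolding dx_def dy_def phi_def k_def l_def by (simp_all only: pdx_cas_phase pdy_cas_phase)
  have d: "dx phi i = (\<lambda>p. A (e i) * k (e i) * cas (- phase a (e i) p))"
    "dy phi i = (\<lambda>p. A (e i) * l (e i) * cas (- phase a (e i) p))"
    "dx (dx phi) i = (\<lambda>p. - (A (e i) * (k (e i))\<^sup>2) * cas (phase a (e i) p))"
    "dy (dy phi) i = (\<lambda>p. - (A (e i) * (l (e i))\<^sup>2) * cas (phase a (e i) p))" for i
    unfolding dx_def[of "dx phi"] dy_def[of "dy phi"] d1 pdx_cas_phase pdy_cas_phase
    by (simp_all add: k_def l_def power2_eq_square mult.assoc)
  have dt1: "dx tau i = (\<lambda>p. 2 * h * \<epsilon> (e i) * A (e i) * k (e i) * cas (- phase a (e i) p))"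
    "dy tau i = (\<lambda>p. 2 * h * \<epsilon> (e i) * A (e i) * l (e i) * cas (- phase a (e i) p))" for i
    unfolding dx_def dy_def tau_def k_def l_def by (simp_all only: pdx_cas_phase pdy_cas_phase)
  have dt: "dx tau i = (\<lambda>p. 2 * h * \<epsilon> (e i) * A (e i) * k (e i) * cas (- phase a (e i) p))"
    "dy tau i = (\<lambda>p. 2 * h * \<epsilon> (e i) * A (e i) * l (e i) * cas (- phase a (e i) p))"
    "dx (dx tau) i = (\<lambda>p. - (2 * h * \<epsilon> (e i) * A (e i) * (k (e i))\<^sup>2) * cas (phase a (e i) p))"
    "dy (dy tau) i = (\<lambda>p. - (2 * h * \<epsilon> (e i) * A (e i) * (l (e i))\<^sup>2) * cas (phase a (e i) p))" for i
    unfolding dx_def[of "dx tau"] dy_def[of "dy tau"] dt1 pdx_cas_phase pdy_cas_phase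
    by (simp_all add: k_def l_def power2_eq_square mult.assoc)
  \<comment> \<open>Products of two unreflected factors (\<open>cc\<close>), two reflected ones
    (\<open>ss\<close>) or one of each (\<open>cs\<close>). Reflection marks a first derivative;
    parity of the coefficients gives a moment in the first two cases and 0 in the last.\<close>
  have cc: "(\<Sum>i\<le>n. (A (e i) * g (e i) * cas (phase a (e i) p)) * (A (e i) * g' (e i) * cas (phase a (e i) p))) =
      (\<Sum>v\<in>F. B v * (g v * g' v))"
    if "\<And>v. g (- v) * g' (- v) = g v * g' v" for g g' p
  proof -
    have "(\<Sum>i\<le>n. (A (e i) * g (e i) * cas (phase a (e i) p)) * (A (e i) * g' (e i) * cas (phase a (e i) p))) =
        (\<Sum>v\<in>F. (B v * (g v * g' v)) * (cas (phase a v p))\<^sup>2)"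
      unfolding re[symmetric] by (intro sum.cong refl) (simp add: AA[symmetric] eF power2_eq_square mult_ac)
    also have "\<dots> = (\<Sum>v\<in>F. B v * (g v * g' v))"
      by (rule sum_even_cas_sq) (simp_all add: neg Bneg that)
    finally show ?thesis .
  qed
  have ss: "(\<Sum>i\<le>n. (A (e i) * g (e i) * cas (- phase a (e i) p)) * (A (e i) * g' (e i) * cas (- phase a (e i) p))) =
      (\<Sum>v\<in>F. B v * (g v * g' v))"
    if "\<And>v. g (- v) * g' (- v) = g v * g' v" for g g' p
  proof -
    have "(\<Sum>i\<le>n. (A (e i) * g (e i) * cas (- phase a (e i) p)) * (A (e i) * g' (e i) * cas (- phase a (e i) p))) =
        (\<Sum>v\<in>F. (B v * (g v * g' v)) * (cas (- phase a v p))\<^sup>2)"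
      unfolding re[symmetric] by (intro sum.cong refl) (simp add: AA[symmetric] eF power2_eq_square mult_ac)
    also have "\<dots> = (\<Sum>v\<in>F. B v * (g v * g' v))"
      by (rule sum_even_cas_sq) (simp_all add: neg Bneg that)
    finally show ?thesis .
  qed
  have cs: "(\<Sum>i\<le>n. (A (e i) * g (e i) * cas (phase a (e i) p)) * (A (e i) * g' (e i) * cas (- phase a (e i) p))) = 0"
    if "\<And>v. g (- v) * g' (- v) = - (g v * g' v)" for g g' p
  proof -
    have "(\<Sum>i\<le>n. (A (e i) * g (e i) * cas (phase a (e i) p)) * (A (e i) * g' (e i) * cas (- phase a (e i) p))) =
        (\<Sum>v\<in>F. (B v * (g v * g' v)) * (cas (phase a v p) * cas (- phase a v p)))"
      unfolding re[symmetric] by (intro sum.cong refl) (simp add: AA[symmetric] eF mult_ac)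
    also have "\<dots> = 0"
      by (rule sum_odd_cas_cas) (simp_all add: neg Bneg that)
    finally show ?thesis .
  qed
  have kk: "(\<Sum>v\<in>F. B v * (k v * k v)) = 1" and ll: "(\<Sum>v\<in>F. B v * (l v * l v)) = 1"
    and kl: "(\<Sum>v\<in>F. B v * (k v * l v)) = 0"
  proof -
    have "(\<Sum>v\<in>F. B v * (k v * k v)) = (\<Sum>v\<in>F. B v * (of_int (fst v))\<^sup>2) / a\<^sup>2"
      "(\<Sum>v\<in>F. B v * (l v * l v)) = (\<Sum>v\<in>F. B v * (of_int (snd v))\<^sup>2) / a\<^sup>2"
      "(\<Sum>v\<in>F. B v * (k v * l v)) = (\<Sum>v\<in>F. B v * of_int (fst v * snd v)) / a\<^sup>2"
      by (simp_all add: sum_divide_distrib k_def l_def power2_eq_square)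
    then show "(\<Sum>v\<in>F. B v * (k v * k v)) = 1" "(\<Sum>v\<in>F. B v * (l v * l v)) = 1"
      "(\<Sum>v\<in>F. B v * (k v * l v)) = 0" using BX BY BXY m0 by simp_all
  qed
  have normkl: "(k v)\<^sup>2 + (l v)\<^sup>2 = 2 - 2 * \<epsilon> v * h" if "v \<in> F" for v
    using norm[OF that] by (simp add: k_def l_def power_divide add_divide_distrib)
  have ee: "\<epsilon> v * \<epsilon> v = 1" for v by (simp add: \<epsilon>_def)
  let ?i = "\<lambda>u v p. ip n (at_pt u p) (at_pt v p)"
  have ip1: "?i phi phi p = 1" for p
    using cc[of "\<lambda>_. 1" "\<lambda>_. 1" p] BF by (simp add: ip_def at_pt_def phi_def)
  have ip2: "?i (dx phi) (dx phi) p = 1" "?i (dy phi) (dy phi) p = 1" "?i (dx phi) (dy phi) p = 0" for p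
    using ss[of k k p] ss[of l l p] ss[of k l p] kk ll kl by (simp_all add: ip_def at_pt_def d kn)
  have ip3: "?i (dx (dx phi)) phi p = - 1" "?i (dy (dy phi)) phi p = - 1" for p
  proof -
    have "?i (dx (dx phi)) phi p = - (\<Sum>v\<in>F. B v * (k v * k v))"
      using cc[of "\<lambda>v. - (k v)\<^sup>2" "\<lambda>_. 1" p]
      by (simp add: ip_def at_pt_def d phi_def kn sum_negf power2_eq_square)
    moreover have "?i (dy (dy phi)) phi p = - (\<Sum>v\<in>F. B v * (l v * l v))"
      using cc[of "\<lambda>v. - (l v)\<^sup>2" "\<lambda>_. 1" p]
      by (simp add: ip_def at_pt_def d phi_def kn sum_negf power2_eq_square)
    ultimately show "?i (dx (dx phi)) phi p = - 1" "?i (dy (dy phi)) phi p = - 1" using kk ll by simp_all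
  qed
  have ten: "tension n phi i p = tau i p" if "i \<le> n" for i p
  proof -
    have "tension n phi i p = (2 - ((k (e i))\<^sup>2 + (l (e i))\<^sup>2)) * (A (e i) * cas (phase a (e i) p))"
      by (simp add: tension_def proj_def ip3 at_pt_apply d phi_def algebra_simps)
    then show ?thesis unfolding normkl[OF eF[OF that]] tau_def by simp
  qed
  have tdx: "dx (tension n phi) i = dx tau i" "dy (tension n phi) i = dy tau i"
     "dx (dx (tension n phi)) i = dx (dx tau) i" "dy (dy (tension n phi)) i = dy (dy tau) i" if "i \<le> n" for i
  proof -
    have "tension n phi i = tau i" using ten[OF that] by blast
    then show "dx (tension n phi) i = dx tau i" "dy (tension n phi) i = dy tau i"
     "dx (dx (tension n phi)) i = dx (dx tau) i" "dy (dy (tension n phi)) i = dy (dy tau) i"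
      by (simp_all add: dx_def dy_def)
  qed
  have tip: "ip n (at_pt (tension n phi) p) u = ip n (at_pt tau p) u"
    "ip n (at_pt (dx (tension n phi)) p) u = ip n (at_pt (dx tau) p) u"
    "ip n (at_pt (dy (tension n phi)) p) u = ip n (at_pt (dy tau) p) u"
    "ip n (at_pt (dx (dx (tension n phi))) p) u = ip n (at_pt (dx (dx tau)) p) u"
    "ip n (at_pt (dy (dy (tension n phi))) p) u = ip n (at_pt (dy (dy tau)) p) u" for p u
    by (simp_all add: ip_def at_pt_def ten tdx)
  have t0: "?i tau (dx phi) p = 0" "?i tau (dy phi) p = 0" "?i (dx tau) phi p = 0" "?i (dy tau) phi p = 0" for p
    using cs[of "\<lambda>v. 2 * h * \<epsilon> v" k p] cs[of "\<lambda>v. 2 * h * \<epsilon> v" l p]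
      cs[of "\<lambda>_. 1" "\<lambda>v. 2 * h * \<epsilon> v * k v" p] cs[of "\<lambda>_. 1" "\<lambda>v. 2 * h * \<epsilon> v * l v" p]
    by (simp_all add: ip_def at_pt_def d dt tau_def phi_def kn eneg mult_ac)
  have tL: "?i (dx (dx tau)) phi p + ?i (dy (dy tau)) phi p = 4 * h\<^sup>2" for p
  proof -
    have "?i (dx (dx tau)) phi p = (\<Sum>v\<in>F. B v * (- (2 * h * \<epsilon> v * (k v)\<^sup>2)))"
      using cc[of "\<lambda>v. - (2 * h * \<epsilon> v * (k v)\<^sup>2)" "\<lambda>_. 1" p]
      by (simp add: ip_def at_pt_def dt phi_def kn eneg mult_ac)
    moreover have "?i (dy (dy tau)) phi p = (\<Sum>v\<in>F. B v * (- (2 * h * \<epsilon> v * (l v)\<^sup>2)))"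
      using cc[of "\<lambda>v. - (2 * h * \<epsilon> v * (l v)\<^sup>2)" "\<lambda>_. 1" p]
      by (simp add: ip_def at_pt_def dt phi_def kn eneg mult_ac)
    ultimately have "?i (dx (dx tau)) phi p + ?i (dy (dy tau)) phi p =
       (\<Sum>v\<in>F. - 2 * h * (B v * \<epsilon> v) * ((k v)\<^sup>2 + (l v)\<^sup>2))"
      by (simp add: sum.distrib[symmetric] algebra_simps)
    also have "\<dots> = (\<Sum>v\<in>F. - 4 * h * (B v * \<epsilon> v) + 4 * h\<^sup>2 * (B v * (\<epsilon> v * \<epsilon> v)))"
      by (intro sum.cong refl) (simp only: normkl, simp add: algebra_simps power2_eq_square)
    \<comment> \<open>The first sum vanishes because the two circles carry equal mass.\<close>
    also have "\<dots> = - 4 * h * sum (\<lambda>v. B v * \<epsilon> v) F + 4 * h\<^sup>2 * sum B F"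
      by (simp add: ee sum.distrib sum_distrib_left sum_negf sum_subtractf)
    finally show ?thesis using BF by simp
  qed
  have tt: "?i tau tau p = 4 * h\<^sup>2" for p
  proof -
    have "?i tau tau p = (\<Sum>v\<in>F. B v * ((2 * h * \<epsilon> v) * (2 * h * \<epsilon> v)))"
      using cc[of "\<lambda>v. 2 * h * \<epsilon> v" "\<lambda>v. 2 * h * \<epsilon> v" p]
      by (simp add: ip_def at_pt_def tau_def eneg mult_ac)
    also have "\<dots> = (\<Sum>v\<in>F. 4 * h\<^sup>2 * (B v * (\<epsilon> v * \<epsilon> v)))"
      by (intro sum.cong refl) (simp add: power2_eq_square)
    also have "\<dots> = 4 * h\<^sup>2 * sum B F" by (simp add: ee sum_distrib_left)
    finally show ?thesis using BF by simp
  qed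
  have mc: "mean_curv n phi p = h" for p
  proof -
    have "?i (\<lambda>i q. tension n phi i q / 2) (\<lambda>i q. tension n phi i q / 2) p = ?i tau tau p / 4"
      by (simp add: ip_def at_pt_def ten sum_divide_distrib)
    then show ?thesis unfolding mean_curv_def using h by (simp add: tt)
  qed
  have bih: "biharmonic n phi"
    unfolding biharmonic_def
  proof (intro allI impI)
    fix i p assume i: "i \<le> n"
    have "bitension n phi i p = dx (dx tau) i p + dy (dy tau) i p
        - (?i (dx (dx tau)) phi p + ?i (dy (dy tau)) phi p) * phi i p + 2 * tau i p"
      unfolding bitension_def Let_def rough_term_def curv_term_def proj_def tip
      by (simp add: t0 ip2 tdx[OF i] ten[OF i] at_pt_apply algebra_simps)
    also have "\<dots> = (2 * h * \<epsilon> (e i) * (2 - ((k (e i))\<^sup>2 + (l (e i))\<^sup>2)) - 4 * h\<^sup>2) * phi i p"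
      unfolding tL by (simp add: dt tau_def phi_def algebra_simps)
    also have "\<dots> = (4 * h\<^sup>2 * (\<epsilon> (e i) * \<epsilon> (e i)) - 4 * h\<^sup>2) * phi i p"
      unfolding normkl[OF eF[OF i]] by (simp add: power2_eq_square)
    finally show "bitension n phi i p = 0" by (simp add: ee)
  qed
  have nh: "\<not> harmonic n phi"
  proof
    assume "harmonic n phi"
    then have "tau i p = 0" if "i \<le> n" for i p using that ten unfolding harmonic_def by metis
    then have "?i tau tau 0 = 0" by (simp add: ip_def at_pt_def)
    with tt h show False by simp
  qed
  have full: "\<forall>i\<le>n. c i = 0" if c: "\<forall>p. ip n c (at_pt phi p) = 0" for c
  proof -
    \<comment> \<open>Coefficients are reindexed by frequency: distinct coordinates carry distinct
      frequencies, so independence of the characters applies.\<close>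
    define inv where "inv = the_inv_into {..n} e"
    have inv: "inv (e i) = i" if "i \<le> n" for i
      using e that by (simp add: inv_def bij_betw_def the_inv_into_f_f)
    have "(\<Sum>v\<in>F. (c (inv v) * A v) * cas (phase a v p)) = 0" for p
    proof -
      have "(\<Sum>v\<in>F. (c (inv v) * A v) * cas (phase a v p)) = ip n c (at_pt phi p)"
        unfolding re[symmetric] ip_def at_pt_def phi_def by (intro sum.cong) (auto simp: inv)
      then show ?thesis using c by metis
    qed
    from cas_phase_independent[OF a fin(3) this] have "c (inv v) * A v = 0" if "v \<in> F" for v
      using that by blast
    then have "c i * A (e i) = 0" if "i \<le> n" for i using eF[OF that] inv[OF that] by metis
    moreover have "A (e i) \<noteq> 0" if "i \<le> n" for i using Bpos[OF eF[OF that]] by (simp add: A_def)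
    ultimately show ?thesis by fastforce
  qed
  have "torus_full_isometric_immersion a n phi"
    unfolding torus_full_isometric_immersion_def
  proof (intro conjI allI impI)
    show "smooth2 (phi i)" for i unfolding phi_def by (rule smooth2_cas_phase)
    have "cas (t + 2 * pi * of_int j) = cas t" for t j
      using sin_cos_add_int_period[of t j 0] by (simp add: cas_def)
    then show "phi i (x + 2 * pi * a, y) = phi i (x, y)" "phi i (x, y + 2 * pi * a) = phi i (x, y)" for i x y
      using a by (simp_all add: phi_def phase_periodic)
  qed (use ip1 ip2 full in blast)+
  with bih nh mc show ?thesis
    unfolding CMC_torus_biharmonic_def proper_biharmonic_def h_def[symmetric] by blast
qed

section \<open>Choice of frequencies\<close>

definition rot :: "int \<times> int \<Rightarrow> int \<times> int" where
  "rot v = (- snd v, fst v)"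

lemma rot_simps [simp]: "rot (rot v) = - v" "rot (- v) = - rot v" "rot v = rot w \<longleftrightarrow> v = w"
  "fst (rot v) = - snd v" "snd (rot v) = fst v"
  by (auto simp: rot_def prod_eq_iff)

lemma rot_invariant_uminus: "- v \<in> T" if "\<And>v. v \<in> T \<Longrightarrow> rot v \<in> T" "v \<in> T"
  using that(1)[OF that(1)[OF that(2)]] by simp

text \<open>Orbits of four points are added one at a time. The bound allows 4 s to exceed the
  cardinality by up to 3: in the induction step it still says that \<open>T\<close> is not all of
  \<open>S\<close>, and this slack yields \<open>four_dvd_card_rot_invariant\<close>.\<close>

lemma rot_invariant_subset:
  assumes "finite S" "(0, 0) \<notin> S" and S: "\<And>v. v \<in> S \<Longrightarrow> rot v \<in> S" and "4 * s < card S + 4"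
  shows "\<exists>T\<subseteq>S. (\<forall>v\<in>T. rot v \<in> T) \<and> card T = 4 * s"
  using assms(4)
proof (induction s)
  case 0
  then show ?case by (intro exI[of _ "{}"]) simp
next
  case (Suc s)
  then obtain T where T: "T \<subseteq> S" "\<And>v. v \<in> T \<Longrightarrow> rot v \<in> T" "card T = 4 * s" by auto
  have finT: "finite T" using T(1) assms(1) finite_subset by blast
  have "T \<noteq> S" using T(3) Suc.prems by auto
  then obtain v where v: "v \<in> S" "v \<notin> T" using T(1) by blast
  define O4 where "O4 = {v, rot v, - v, - rot v}"
  have "v \<noteq> (0, 0)" using v(1) assms(2) by blast
  then have "v \<noteq> rot v" "v \<noteq> - v" "v \<noteq> - rot v" "rot v \<noteq> - v" "rot v \<noteq> - rot v" "- v \<noteq> - rot v"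
    by (simp_all add: prod_eq_iff) linarith+
  then have card4: "card O4 = 4"
    unfolding O4_def by (simp add: card_insert_if)
  have neg: "w \<in> T" if "- w \<in> T" for w
    using rot_invariant_uminus[OF T(2) that] by simp
  have "rot v \<notin> T"
  proof
    assume "rot v \<in> T"
    from T(2)[OF this] show False using neg[of v] v(2) by simp
  qed
  then have "T \<inter> O4 = {}" using neg[of v] neg[of "rot v"] v(2) by (auto simp: O4_def)
  then have "card (T \<union> O4) = 4 * Suc s"
    using T(3) card4 finT by (subst card_Un_disjoint) (auto simp: O4_def)
  moreover have "T \<union> O4 \<subseteq> S"
    using T(1) v(1) S rot_invariant_uminus[OF S] by (auto simp: O4_def)
  moreover have "\<forall>w\<in>T \<union> O4. rot w \<in> T \<union> O4"
    using T(2) by (auto simp: O4_def)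
  ultimately show ?case by blast
qed

text \<open>The number of orbits is rounded up; the subset it provides fits inside \<open>S\<close>,
  so nothing was rounded.\<close>

lemma four_dvd_card_rot_invariant:
  assumes "finite S" "(0, 0) \<notin> S" "\<And>v. v \<in> S \<Longrightarrow> rot v \<in> S"
  shows "4 dvd card S"
proof -
  define s where "s = (card S + 3) div 4"
  have "4 * s < card S + 4" by (simp add: s_def)
  then obtain T where "T \<subseteq> S" "card T = 4 * s"
    using rot_invariant_subset[OF assms] by blast
  then have "4 * s \<le> card S" using card_mono[OF assms(1)] by metis
  then have "card S = 4 * s" unfolding s_def by linarith
  then show ?thesis by simp
qed

abbreviation level :: "nat \<Rightarrow> (int \<times> int) set" where
  "level m \<equiv> {v. (fst v)\<^sup>2 + (snd v)\<^sup>2 = int m}"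

lemma level_rot:
  assumes "0 < m"
  shows "finite (level m)" "(0, 0) \<notin> level m" "v \<in> level m \<Longrightarrow> rot v \<in> level m"
  using assms finite_norm_level by (auto simp: add.commute)

lemma four_dvd_r2: "0 < m \<Longrightarrow> 4 dvd r2 m"
  unfolding r2_def by (rule four_dvd_card_rot_invariant) (use level_rot in blast)+

lemma r2_ge_4: "0 < p\<^sup>2 + q\<^sup>2 \<Longrightarrow> 4 \<le> r2 (p\<^sup>2 + q\<^sup>2)"
proof -
  assume m: "0 < p\<^sup>2 + q\<^sup>2"
  have "(int p, int q) \<in> level (p\<^sup>2 + q\<^sup>2)" by simp
  then have "level (p\<^sup>2 + q\<^sup>2) \<noteq> {}" by blast
  then have "r2 (p\<^sup>2 + q\<^sup>2) \<noteq> 0"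
    unfolding r2_def using level_rot(1)[OF m] by (simp only: card_eq_0_iff) simp
  with four_dvd_r2[OF m] show ?thesis by (auto dest: dvd_imp_le)
qed

lemma weighted_freqs_rot_invariant:
  assumes fin: "finite T" and rot: "\<And>v. v \<in> T \<Longrightarrow> rot v \<in> T" and T: "T \<subseteq> level m"
    and M: "T \<noteq> {} \<Longrightarrow> 0 < M" "T = {} \<Longrightarrow> M = 0"
  shows "weighted_freqs T (\<lambda>_. M / card T) m M (M * m / 2) (M * m / 2)"
proof -
  let ?c = "M / card T"
  have neg: "- v \<in> T" if "v \<in> T" for v using rot_invariant_uminus[OF rot that] .
  have re: "(\<Sum>v\<in>T. g (rot v)) = sum g T" for g :: "_ \<Rightarrow> real"
    by (rule sum.reindex_bij_witness[of _ "\<lambda>v. - rot v" rot]) (auto simp: rot neg)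
  have mass: "?c * card T = M" using M fin by (cases "T = {}") auto
  have "(\<Sum>v\<in>T. (real_of_int (fst v))\<^sup>2) = (\<Sum>v\<in>T. (real_of_int (snd v))\<^sup>2)"
    using re[of "\<lambda>v. (of_int (fst v))\<^sup>2"] by simp
  moreover have "(\<Sum>v\<in>T. (real_of_int (fst v))\<^sup>2) + (\<Sum>v\<in>T. (real_of_int (snd v))\<^sup>2) = card T * real m"
  proof -
    have "(real_of_int (fst v))\<^sup>2 + (real_of_int (snd v))\<^sup>2 = real m" if "v \<in> T" for v
    proof -
      have "(fst v)\<^sup>2 + (snd v)\<^sup>2 = int m" using that T by blast
      from arg_cong[OF this, of real_of_int] show ?thesis by simp
    qed
    then show ?thesis by (simp add: sum.distrib[symmetric])
  qed
  ultimately have sq: "(\<Sum>v\<in>T. (real_of_int (fst v))\<^sup>2) = card T * real m / 2"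
    "(\<Sum>v\<in>T. (real_of_int (snd v))\<^sup>2) = card T * real m / 2" by simp_all
  have "(\<Sum>v\<in>T. real_of_int (fst v * snd v)) = - (\<Sum>v\<in>T. real_of_int (fst v * snd v))"
    using re[of "\<lambda>v. real_of_int (fst v * snd v)"] by (simp add: sum_negf mult.commute)
  then have xy: "(\<Sum>v\<in>T. real_of_int (fst v * snd v)) = 0" by simp
  have "0 < ?c" if "v \<in> T" for v
    using M that fin by (auto intro!: divide_pos_pos simp: card_gt_0_iff)
  moreover have "?c * (card T * real m / 2) = M * m / 2" using mass by (metis mult.assoc times_divide_eq_right)
  ultimately show ?thesis
    unfolding weighted_freqs_def sum_distrib_left[symmetric] sq xy
    using fin neg T mass by (auto simp: mult.commute)
qed

lemma weighted_freqs_pair: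
  assumes "0 < w" "v \<noteq> (0, 0)" "v \<in> level m" "fst v * snd v = 0"
  shows "weighted_freqs {v, - v} (\<lambda>_. w / 2) m w (w * (of_int (fst v))\<^sup>2) (w * (of_int (snd v))\<^sup>2)"
proof -
  have "v \<noteq> - v" using assms(2) by (auto simp: prod_eq_iff)
  then show ?thesis
    using assms unfolding weighted_freqs_def by (auto simp: algebra_simps)
qed

lemma weighted_freqs_Un:
  assumes F: "weighted_freqs F B m M X Y" and G: "weighted_freqs G C m M' X' Y'" and disj: "F \<inter> G = {}"
  shows "weighted_freqs (F \<union> G) (\<lambda>v. if v \<in> F then B v else C v) m (M + M') (X + X') (Y + Y')"
proof -
  note W = F[unfolded weighted_freqs_def] G[unfolded weighted_freqs_def]
  have neg: "- v \<in> F \<longleftrightarrow> v \<in> F" for v using W(1) by (metis minus_minus)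
  have nF: "v \<notin> F" if "v \<in> G" for v using that disj by blast
  have un: "sum g (F \<union> G) = sum g F + sum g G" for g :: "_ \<Rightarrow> real"
    using W disj by (intro sum.union_disjoint) auto
  show ?thesis
    using W unfolding weighted_freqs_def un by (auto simp: nF neg cong: sum.cong)
qed

lemma cmc_biharmonic_isotropic:
  assumes a: "a > 0" and m: "0 < m1" "m1 < m2" and a2: "4 * a\<^sup>2 = real (m1 + m2)"
    and r: "4 \<le> r2 m1" "4 \<le> r2 m2" and n: "n mod 4 = 3" "7 \<le> n" "n + 1 \<le> r2 m1 + r2 m2"
  shows "CMC_torus_biharmonic a n ((real m2 - real m1) / real (m1 + m2))"
proof -
  obtain S1 S2 where S: "r2 m1 = 4 * S1" "r2 m2 = 4 * S2"
    using four_dvd_r2[of m1] four_dvd_r2[of m2] m by (auto elim!: dvdE)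
  define s where "s = (n + 1) div 4"
  have s: "n + 1 = 4 * s" unfolding s_def using n(1) by presburger
  \<comment> \<open>As many orbits as possible go to the first circle while one is left for the
    second; \<open>7 \<le> n\<close> means at least two orbits, so neither circle is empty.\<close>
  define s1 s2 where "s1 = min S1 (s - 1)" and "s2 = s - s1"
  have bounds: "1 \<le> s1" "1 \<le> s2" "s1 \<le> S1" "s2 \<le> S2" "s1 + s2 = s"
    using n(2,3) s S r by (auto simp: s1_def s2_def)
  have lev: "\<exists>T\<subseteq>level m. (\<forall>v\<in>T. rot v \<in> T) \<and> card T = 4 * k" if "0 < m" "4 * k \<le> r2 m" for m k
    using rot_invariant_subset[OF level_rot(1,2)[OF that(1)] level_rot(3)[OF that(1)], of k] that(2)
    unfolding r2_def by simp
  obtain T1 where T1: "T1 \<subseteq> level m1" "\<And>v. v \<in> T1 \<Longrightarrow> rot v \<in> T1" "card T1 = 4 * s1"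
    using lev[of m1 s1] m bounds S by auto
  obtain T2 where T2: "T2 \<subseteq> level m2" "\<And>v. v \<in> T2 \<Longrightarrow> rot v \<in> T2" "card T2 = 4 * s2"
    using lev[of m2 s2] m bounds S by auto
  have "finite T1" "finite T2" "T1 \<noteq> {}" "T2 \<noteq> {}" using T1(3) T2(3) bounds by (auto intro: card_ge_0_finite)
  then have W: "weighted_freqs T1 (\<lambda>_. (1/2) / card T1) m1 (1/2) ((1/2) * m1 / 2) ((1/2) * m1 / 2)"
    "weighted_freqs T2 (\<lambda>_. (1/2) / card T2) m2 (1/2) ((1/2) * m2 / 2) ((1/2) * m2 / 2)"
    using T1 T2 by (intro weighted_freqs_rot_invariant; simp)+
  show ?thesis
    by (rule cmc_biharmonic_of_weighted_freqs[OF a W m(2) a2])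
      (use a2 T1(3) T2(3) s bounds in auto)
qed

text \<open>Six axis points and \<open>s\<close> whole orbits make up n + 1 frequencies. The points
  (p, 0), (-p, 0) favour the first direction by \<open>\<alpha>\<close> p^2; the axis points of the
  larger circle favour the second by the same amount.\<close>

lemma cmc_biharmonic_axis:
  assumes a: "a > 0" and pq: "0 < p" "p < q" and a2: "4 * a\<^sup>2 = real (p\<^sup>2 + q\<^sup>2)"
    and n: "n mod 4 = 1" "5 \<le> n" "n + 1 \<le> r2 (p\<^sup>2) + r2 (q\<^sup>2)"
  shows "CMC_torus_biharmonic a n ((real (q\<^sup>2) - real (p\<^sup>2)) / real (p\<^sup>2 + q\<^sup>2))"
proof -
  have q: "0 < q" using pq by simp
  obtain S1 S2 where S: "r2 (p\<^sup>2) = 4 * S1" "r2 (q\<^sup>2) = 4 * S2"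
    using four_dvd_r2[of "p\<^sup>2"] four_dvd_r2[of "q\<^sup>2"] pq q by (auto elim!: dvdE)
  have S1: "1 \<le> S1" "1 \<le> S2"
    using r2_ge_4[of p 0] r2_ge_4[of q 0] S pq q by auto
  define s where "s = (n - 5) div 4"
  have s: "n + 1 = 6 + 4 * s" unfolding s_def using n(1,2) by presburger
  \<comment> \<open>One orbit on each circle is reserved for the axis points. Since 6 + 4 s is at
    most 4 S1 + 4 S2, divisibility gives \<open>s\<close> at most (S1 - 1) + (S2 - 1).\<close>
  define t u where "t = min s (S1 - 1)" and "u = s - t"
  have tu: "t \<le> S1 - 1" "u \<le> S2 - 1" "t + u = s"
    using n(3) s S S1 by (auto simp: t_def u_def)
  \<comment> \<open>The whole axis orbit is removed even from the smaller circle, where only half of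
    it is used, so that the rest stays invariant.\<close>
  define ax :: "nat \<Rightarrow> (int \<times> int) set" where
    "ax m = {(int m, 0), - (int m, 0)} \<union> {(0, int m), - (0, int m)}" for m
  have lev: "\<exists>T\<subseteq>level (m\<^sup>2) - ax m. (\<forall>v\<in>T. rot v \<in> T) \<and> card T = 4 * k"
    if "0 < m" "r2 (m\<^sup>2) = 4 * K" "1 \<le> K" "k \<le> K - 1" for m k K
  proof (rule rot_invariant_subset)
    have m2: "0 < m\<^sup>2" using that by simp
    show "finite (level (m\<^sup>2) - ax m)" "(0, 0) \<notin> level (m\<^sup>2) - ax m" using level_rot[OF m2] by auto
    show "rot v \<in> level (m\<^sup>2) - ax m" if "v \<in> level (m\<^sup>2) - ax m" for v
      using that by (cases v) (auto simp: ax_def rot_def add.commute)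
    have "ax m \<subseteq> level (m\<^sup>2)" by (auto simp: ax_def)
    then have "card (level (m\<^sup>2) - ax m) = r2 (m\<^sup>2) - card (ax m)"
      unfolding r2_def by (intro card_Diff_subset) (auto simp: ax_def)
    moreover have "card (ax m) = 4" using that(1) by (auto simp: ax_def card_insert_if)
    ultimately show "4 * k < card (level (m\<^sup>2) - ax m) + 4" using that by simp
  qed
  obtain T where T: "T \<subseteq> level (p\<^sup>2) - ax p" "\<And>v. v \<in> T \<Longrightarrow> rot v \<in> T" "card T = 4 * t"
    using lev[OF pq(1) S(1) S1(1) tu(1)] by auto
  obtain U where U: "U \<subseteq> level (q\<^sup>2) - ax q" "\<And>v. v \<in> U \<Longrightarrow> rot v \<in> U" "card U = 4 * u"
    using lev[OF q S(2) S1(2) tu(2)] by auto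
  have fin: "finite T" "finite U"
    using T(1) U(1) level_rot(1)[of "p\<^sup>2"] level_rot(1)[of "q\<^sup>2"] pq q
    by (auto intro: finite_subset)
  \<comment> \<open>Any mass strictly between 0 and 1/2 would serve for a nonempty \<open>T\<close>;
    \<open>\<alpha>\<close> is what remains for (p, 0) and (-p, 0).\<close>
  define M where "M = (if T = {} then 0 else 1 / 4 :: real)"
  define \<alpha> where "\<alpha> = 1 / 2 - M"
  \<comment> \<open>The required imbalance w2 - w1, from the equation \<alpha> p^2 + w1 q^2 = w2
    q^2. As p < q it stays below 1/2, and giving \<open>U\<close> half of 1/2 - \<beta> keeps
    \<open>w1\<close> positive.\<close>
  define \<beta> where "\<beta> = \<alpha> * (real p)\<^sup>2 / (real q)\<^sup>2"
  define M' where "M' = (if U = {} then 0 else (1 / 2 - \<beta>) / 2)"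
  define w1 w2 where "w1 = (1 / 2 - M' - \<beta>) / 2" and "w2 = (1 / 2 - M' + \<beta>) / 2"
  have \<alpha>: "0 < \<alpha>" "\<alpha> \<le> 1 / 2" by (auto simp: \<alpha>_def M_def)
  have \<beta>q: "\<beta> * (real q)\<^sup>2 = \<alpha> * (real p)\<^sup>2" using q by (simp add: \<beta>_def)
  have "(real p)\<^sup>2 < (real q)\<^sup>2" using pq by (intro power_strict_mono) auto
  then have "\<beta> * (real q)\<^sup>2 < \<alpha> * (real q)\<^sup>2" unfolding \<beta>q using \<alpha> by simp
  then have \<beta>: "\<beta> < 1 / 2" using \<alpha> by (auto simp: mult_less_cancel_right)
  have \<beta>0: "0 < \<beta>" using \<alpha> pq q by (simp add: \<beta>_def)
  have w: "0 < w1" "0 < w2" using \<beta> \<beta>0 by (auto simp: w1_def w2_def M'_def field_simps)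
  define P Q1 Q2 :: "(int \<times> int) set" where "P = {(int p, 0), - (int p, 0)}" and "Q1 = {(int q, 0), - (int q, 0)}"
    and "Q2 = {(0, int q), - (0, int q)}"
  have WP: "weighted_freqs P (\<lambda>_. \<alpha> / 2) (p\<^sup>2) \<alpha> (\<alpha> * (real p)\<^sup>2) 0"
    using weighted_freqs_pair[of \<alpha> "(int p, 0)" "p\<^sup>2"] \<alpha> pq by (simp add: P_def)
  have WQ1: "weighted_freqs Q1 (\<lambda>_. w1 / 2) (q\<^sup>2) w1 (w1 * (real q)\<^sup>2) 0"
    using weighted_freqs_pair[of w1 "(int q, 0)" "q\<^sup>2"] w q by (simp add: Q1_def)
  have WQ2: "weighted_freqs Q2 (\<lambda>_. w2 / 2) (q\<^sup>2) w2 0 (w2 * (real q)\<^sup>2)"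
    using weighted_freqs_pair[of w2 "(0, int q)" "q\<^sup>2"] w q by (simp add: Q2_def)
  have WT: "weighted_freqs T (\<lambda>_. M / card T) (p\<^sup>2) M (M * (p\<^sup>2) / 2) (M * (p\<^sup>2) / 2)"
    using T fin by (intro weighted_freqs_rot_invariant) (auto simp: M_def)
  have WU: "weighted_freqs U (\<lambda>_. M' / card U) (q\<^sup>2) M' (M' * (q\<^sup>2) / 2) (M' * (q\<^sup>2) / 2)"
    using U fin \<beta> by (intro weighted_freqs_rot_invariant) (auto simp: M'_def)
  have dT: "P \<inter> T = {}" using T(1) by (auto simp: P_def ax_def)
  have dQ: "Q1 \<inter> Q2 = {}" using q by (auto simp: Q1_def Q2_def)
  have dU: "(Q1 \<union> Q2) \<inter> U = {}" using U(1) by (auto simp: Q1_def Q2_def ax_def)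
  have sums: "\<alpha> + M = 1 / 2" "w1 + w2 + M' = 1 / 2" by (simp_all add: \<alpha>_def w1_def w2_def field_simps)
  have card: "card (P \<union> T) + card (Q1 \<union> Q2 \<union> U) = n + 1"
  proof -
    have "card P = 2" "card Q1 = 2" "card Q2 = 2" using pq q by (auto simp: P_def Q1_def Q2_def)
    moreover have "finite P" "finite Q1" "finite Q2" by (auto simp: P_def Q1_def Q2_def)
    ultimately show ?thesis
      using fin T(3) U(3) s tu(3) by (simp add: card_Un_disjoint dT dQ dU)
  qed
  have eqs: "\<alpha> * (real p)\<^sup>2 + M * (p\<^sup>2) / 2 + (w1 * (real q)\<^sup>2 + 0 + M' * (q\<^sup>2) / 2) = a\<^sup>2"
    "0 + M * (p\<^sup>2) / 2 + (0 + w2 * (real q)\<^sup>2 + M' * (q\<^sup>2) / 2) = a\<^sup>2"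
  proof -
    have "w1 * (real q)\<^sup>2 + M' * (real q)\<^sup>2 / 2 = (real q)\<^sup>2 / 4 - \<beta> * (real q)\<^sup>2 / 2"
      "w2 * (real q)\<^sup>2 + M' * (real q)\<^sup>2 / 2 = (real q)\<^sup>2 / 4 + \<beta> * (real q)\<^sup>2 / 2"
      by (simp_all add: w1_def w2_def algebra_simps add_divide_distrib diff_divide_distrib)
    moreover have "M * (real p)\<^sup>2 = (real p)\<^sup>2 / 2 - \<alpha> * (real p)\<^sup>2"
      by (simp add: \<alpha>_def algebra_simps)
    moreover have "4 * a\<^sup>2 = (real p)\<^sup>2 + (real q)\<^sup>2" using a2 by simp
    ultimately show "\<alpha> * (real p)\<^sup>2 + M * (p\<^sup>2) / 2 + (w1 * (real q)\<^sup>2 + 0 + M' * (q\<^sup>2) / 2) = a\<^sup>2"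
      "0 + M * (p\<^sup>2) / 2 + (0 + w2 * (real q)\<^sup>2 + M' * (q\<^sup>2) / 2) = a\<^sup>2"
      unfolding of_nat_power using \<beta>q by - linarith+
  qed
  have "p\<^sup>2 < q\<^sup>2" using pq by (intro power_strict_mono) auto
  from cmc_biharmonic_of_weighted_freqs[OF a weighted_freqs_Un[OF WP WT dT, unfolded sums]
      weighted_freqs_Un[OF weighted_freqs_Un[OF WQ1 WQ2 dQ] WU dU, unfolded sums] this a2 eqs card]
  show ?thesis .
qed

theorem theorem3p8:
  fixes a :: real
  assumes "a > 0"
  shows "(\<forall>n h. n mod 4 = 3 \<longrightarrow> 0 < h \<longrightarrow> h < 1 \<longrightarrow>
            (CMC_torus_biharmonic a n h \<longleftrightarrow>
              (\<exists>p1 q1 p2 q2 :: nat.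
                 0 < p1^2 + q1^2 \<and> p1^2 + q1^2 < p2^2 + q2^2 \<and>
                 4 * a^2 = real (p1^2 + q1^2 + p2^2 + q2^2) \<and>
                 h = (real (p2^2 + q2^2) - real (p1^2 + q1^2)) / real (p1^2 + q1^2 + p2^2 + q2^2) \<and>
                 7 \<le> n \<and> n + 1 \<le> r2 (p1^2 + q1^2) + r2 (p2^2 + q2^2))))
       \<and> (\<forall>p q :: nat. 4 * a^2 = real (p^2 + q^2) \<longrightarrow> 0 < p \<longrightarrow> p < q \<longrightarrow>
            (\<forall>n. odd n \<longrightarrow> 5 \<le> n \<longrightarrow> n + 1 \<le> r2 (p^2) + r2 (q^2) \<longrightarrow>
               CMC_torus_biharmonic a n ((real q^2 - real p^2) / (real p^2 + real q^2))))"
proof (intro conjI allI impI iffI)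
  fix n :: nat and h :: real
  assume n: "n mod 4 = 3" and h: "0 < h" "h < 1" and "CMC_torus_biharmonic a n h"
  then obtain phi where phi: "torus_full_isometric_immersion a n phi" "biharmonic n phi"
    "\<And>p. mean_curv n phi p = h"
    unfolding CMC_torus_biharmonic_def proper_biharmonic_def by blast
  \<comment> \<open>After 3 the next dimension in the residue class is 7.\<close>
  have "n \<noteq> 3" using codimension_one_minimal[OF assms phi] h by auto
  then have "7 \<le> n" using n by presburger
  with cmc_biharmonic_necessary[OF assms phi h]
  show "\<exists>p1 q1 p2 q2 :: nat.
                 0 < p1^2 + q1^2 \<and> p1^2 + q1^2 < p2^2 + q2^2 \<and>
                 4 * a^2 = real (p1^2 + q1^2 + p2^2 + q2^2) \<and>
                 h = (real (p2^2 + q2^2) - real (p1^2 + q1^2)) / real (p1^2 + q1^2 + p2^2 + q2^2) \<and>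
                 7 \<le> n \<and> n + 1 \<le> r2 (p1^2 + q1^2) + r2 (p2^2 + q2^2)"
    by blast
next
  fix n :: nat and h :: real
  assume n: "n mod 4 = 3"
  assume "\<exists>p1 q1 p2 q2 :: nat.
                 0 < p1^2 + q1^2 \<and> p1^2 + q1^2 < p2^2 + q2^2 \<and>
                 4 * a^2 = real (p1^2 + q1^2 + p2^2 + q2^2) \<and>
                 h = (real (p2^2 + q2^2) - real (p1^2 + q1^2)) / real (p1^2 + q1^2 + p2^2 + q2^2) \<and>
                 7 \<le> n \<and> n + 1 \<le> r2 (p1^2 + q1^2) + r2 (p2^2 + q2^2)"
  then obtain p1 q1 p2 q2 :: nat where H: "0 < p1^2 + q1^2" "p1^2 + q1^2 < p2^2 + q2^2"
    "4 * a^2 = real (p1^2 + q1^2 + p2^2 + q2^2)"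
    "h = (real (p2^2 + q2^2) - real (p1^2 + q1^2)) / real (p1^2 + q1^2 + p2^2 + q2^2)"
    "7 \<le> n" "n + 1 \<le> r2 (p1^2 + q1^2) + r2 (p2^2 + q2^2)"
    by (elim exE conjE) (rule that)
  have "0 < p2^2 + q2^2" using H(2) by linarith
  from r2_ge_4[OF H(1)] r2_ge_4[OF this]
  have "4 \<le> r2 (p1^2 + q1^2)" "4 \<le> r2 (p2^2 + q2^2)" .
  from cmc_biharmonic_isotropic[OF assms H(1,2) _ this n H(5,6)] H(3)
  show "CMC_torus_biharmonic a n h" unfolding H(4) by (simp add: add.assoc)
next
  fix p q n :: nat
  assume H: "4 * a^2 = real (p^2 + q^2)" "0 < p" "p < q" "odd n" "5 \<le> n" "n + 1 \<le> r2 (p^2) + r2 (q^2)"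
  have h: "(real q^2 - real p^2) / (real p^2 + real q^2) =
      (real (q^2) - real (p^2)) / real (p^2 + q^2)" by simp
  \<comment> \<open>Whole orbits suffice in the class of 3, where \<open>5 \<le> n\<close> already
    gives \<open>7 \<le> n\<close>; the class of 1 needs the axis points.\<close>
  have "n mod 4 = 1 \<or> n mod 4 = 3" using \<open>odd n\<close> by presburger
  then show "CMC_torus_biharmonic a n ((real q^2 - real p^2) / (real p^2 + real q^2))"
  proof
    assume "n mod 4 = 1"
    then show ?thesis unfolding h using cmc_biharmonic_axis[OF assms H(2,3,1)] H(5,6) by blast
  next
    assume n: "n mod 4 = 3"
    then have "7 \<le> n" using H(5) by presburger
    moreover have "4 \<le> r2 (p^2)" "4 \<le> r2 (q^2)" using r2_ge_4[of p 0] r2_ge_4[of q 0] H(2,3) by auto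
    moreover have "p^2 < q^2" using H(2,3) by (intro power_strict_mono) auto
    ultimately show ?thesis unfolding h using H n by (intro cmc_biharmonic_isotropic[OF assms]) auto
  qed
qed

end
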